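(* Let $A$ be a finite abelian group, let $G$ be a polysurface group of length $n$ with filtration $1=G_0<G_1<\dots<G_n=G$, and let $1\to A\to\Gamma\xrightarrow{\phi}G\to1$ be a central extension. Let $G_1'$ be a finite index normal subgroup of $G_1$ with $[G_1:G_1']\le e(A)$, such that $G_1/G_1'$ is cyclic and the induced extension $1\to A\to\phi^{-1}(G_1')\to G_1'\to1$ is trivial. Let $i:G_1'\to\Gamma$ be a lift of $G_1'$. Then the normalizer $N_\Gamma(i(G_1'))$ is of finite index in $\Gamma$, with index less than $$|A|^{2e(A) g_1(G)}\cdot e(A)\,(e(A)!)^{2g_1(G)+|r(A)|}.$$
   Context: A surface group is the fundamental group of a closed orientable surface of genus at least $2$. A group $G$ is a polysurface group of length $n$ with filtration $1=G_0<G_1<\dots<G_n=G$ if each $G_i$ is normal in $G$ and each $G_i/G_{i-1}$ ($1\le i\le n$) is a surface group; $g_1(G)$ is the genus of the surface group $G_1$. For a finite abelian group $A$, $e(A)$ is its exponent and $r(A)$ is a generating set of $A$ of minimal size. A central extension is trivial if it is isomorphic as an extension to the product extension. A lift of $G_1'$ is a group homomorphism $i:G_1'\to\Gamma$ with $\phi\circ i$ equal to the inclusion $G_1'\hookrightarrow G$ (such a lift exists since the extension is trivial over $G_1'$).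
   Formalization: For trivial A the index and the bound both equal 1, so the strict inequality fails; the formal statement asserts "at most" the bound for every A and "less than" whenever A is nontrivial. *)

theory Defs
  imports "HOL-Analysis.Analysis" "HOL-Algebra.Algebra"
begin

definition homotopy_class :: "'a::real_normed_vector set \<Rightarrow> (real \<Rightarrow> 'a) \<Rightarrow> (real \<Rightarrow> 'a) set" where
  "homotopy_class S p = {q. homotopic_paths S p q}"

definition loops_at :: "'a::real_normed_vector set \<Rightarrow> 'a \<Rightarrow> (real \<Rightarrow> 'a) set" where
  "loops_at S x = {p. path p \<and> path_image p \<subseteq> S \<and> pathstart p = x \<and> pathfinish p = x}"

text \<open>The product of two classes is written as a union over representatives; by
  homotopy invariance of concatenation it is the class of \<open>p +++ q\<close> for any choice
  of \<open>p \<in> P\<close> and \<open>q \<in> Q\<close>.\<close>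

definition fundamental_group ::
  "'a::real_normed_vector set \<Rightarrow> 'a \<Rightarrow> (real \<Rightarrow> 'a) set monoid" where
  "fundamental_group S x =
     \<lparr>carrier = homotopy_class S ` loops_at S x,
      monoid.mult = (\<lambda>P Q. \<Union>p\<in>P. \<Union>q\<in>Q. homotopy_class S (p +++ q)),
      one = homotopy_class S (linepath x x)\<rparr>"

lemma homotopy_class_eqI:
  assumes "homotopic_paths S p q"
  shows "homotopy_class S p = homotopy_class S q"
proof -
  have "homotopic_paths S p r \<longleftrightarrow> homotopic_paths S q r" for r
    using assms homotopic_paths_sym[of S p q] homotopic_paths_trans[of S p q r]
      homotopic_paths_trans[of S q p r] by argo
  then show ?thesis
    unfolding homotopy_class_def by presburger
qed

lemma fundamental_group_mult:
  assumes "p \<in> loops_at S x" "q \<in> loops_at S x"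
  shows "homotopy_class S p \<otimes>\<^bsub>fundamental_group S x\<^esub> homotopy_class S q
         = homotopy_class S (p +++ q)"
proof -
  have refl: "homotopic_paths S p p" "homotopic_paths S q q"
    using assms by (auto simp: loops_at_def)
  have "homotopy_class S (p' +++ q') = homotopy_class S (p +++ q)"
    if "p' \<in> homotopy_class S p" "q' \<in> homotopy_class S q" for p' q'
  proof -
    have "homotopic_paths S (p +++ q) (p' +++ q')"
      using that assms by (intro homotopic_paths_join) (auto simp: homotopy_class_def loops_at_def)
    then show ?thesis
      by (rule homotopy_class_eqI[symmetric])
  qed
  moreover have "p \<in> homotopy_class S p" "q \<in> homotopy_class S q"
    using refl by (auto simp: homotopy_class_def)
  ultimately have "(\<Union>p'\<in>homotopy_class S p. \<Union>q'\<in>homotopy_class S q.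
      homotopy_class S (p' +++ q')) = homotopy_class S (p +++ q)"
    by blast
  then show ?thesis
    by (simp add: fundamental_group_def)
qed

lemma group_fundamental_group:
  assumes "x \<in> S"
  shows "group (fundamental_group S x)"
proof (rule groupI)
  let ?G = "fundamental_group S x"
  have carr: "carrier ?G = homotopy_class S ` loops_at S x"
    by (simp add: fundamental_group_def)
  have one: "\<one>\<^bsub>?G\<^esub> = homotopy_class S (linepath x x)"
    by (simp add: fundamental_group_def)
  have join: "p +++ q \<in> loops_at S x" if "p \<in> loops_at S x" "q \<in> loops_at S x" for p q
    using that by (auto simp: loops_at_def path_image_join)
  have lin: "linepath x x \<in> loops_at S x"
    using assms by (auto simp: loops_at_def)
  have rev: "reversepath p \<in> loops_at S x" if "p \<in> loops_at S x" for p
    using that by (auto simp: loops_at_def)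
  show "\<one>\<^bsub>?G\<^esub> \<in> carrier ?G" using lin by (auto simp: carr one)
  show "P \<otimes>\<^bsub>?G\<^esub> Q \<in> carrier ?G" if "P \<in> carrier ?G" "Q \<in> carrier ?G" for P Q
    using that join by (auto simp: carr fundamental_group_mult)
  show "P \<otimes>\<^bsub>?G\<^esub> Q \<otimes>\<^bsub>?G\<^esub> R = P \<otimes>\<^bsub>?G\<^esub> (Q \<otimes>\<^bsub>?G\<^esub> R)"
    if "P \<in> carrier ?G" "Q \<in> carrier ?G" "R \<in> carrier ?G" for P Q R
  proof -
    obtain p q r where pqr: "p \<in> loops_at S x" "q \<in> loops_at S x" "r \<in> loops_at S x"
      "P = homotopy_class S p" "Q = homotopy_class S q" "R = homotopy_class S r"
      using \<open>P \<in> carrier ?G\<close> \<open>Q \<in> carrier ?G\<close> \<open>R \<in> carrier ?G\<close> by (auto simp: carr)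
    have "homotopic_paths S (p +++ (q +++ r)) ((p +++ q) +++ r)"
      using pqr by (intro homotopic_paths_assoc) (auto simp: loops_at_def)
    then show ?thesis using pqr by (simp add: fundamental_group_mult join homotopy_class_eqI)
  qed
  show "\<one>\<^bsub>?G\<^esub> \<otimes>\<^bsub>?G\<^esub> P = P" if "P \<in> carrier ?G" for P
  proof -
    obtain p where p: "p \<in> loops_at S x" "P = homotopy_class S p"
      using \<open>P \<in> carrier ?G\<close> by (auto simp: carr)
    then have "homotopic_paths S (linepath x x +++ p) p"
      by (intro homotopic_paths_lid') (auto simp: loops_at_def)
    then show ?thesis using p lin by (simp add: one fundamental_group_mult homotopy_class_eqI)
  qed
  show "\<exists>Q\<in>carrier ?G. Q \<otimes>\<^bsub>?G\<^esub> P = \<one>\<^bsub>?G\<^esub>" if "P \<in> carrier ?G" for P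
  proof -
    obtain p where p: "p \<in> loops_at S x" "P = homotopy_class S p"
      using \<open>P \<in> carrier ?G\<close> by (auto simp: carr)
    then have "homotopic_paths S (reversepath p +++ p) (linepath x x)"
      using homotopic_paths_linv[of p S] by (auto simp: loops_at_def)
    then have "homotopy_class S (reversepath p) \<otimes>\<^bsub>?G\<^esub> P = \<one>\<^bsub>?G\<^esub>"
      using p rev by (simp add: one fundamental_group_mult homotopy_class_eqI)
    then show ?thesis using p rev by (auto simp: carr)
  qed
qed

text \<open>The closed orientable surface of genus \<open>g\<close> is the \<open>4 * g\<close>-gon with its sides
  identified in pairs according to the boundary word
  \<open>a\<^sub>0 b\<^sub>0 a\<^sub>0\<^sup>-\<^sup>1 b\<^sub>0\<^sup>-\<^sup>1 a\<^sub>1 b\<^sub>1 a\<^sub>1\<^sup>-\<^sup>1 b\<^sub>1\<^sup>-\<^sup>1 \<dots>\<close>.  The polygon is the closed unit disc; its \<open>k\<close>-th side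
  is the arc \<open>polygon_boundary g s\<close> with \<open>k \<le> s \<le> k + 1\<close>.\<close>

definition polygon_boundary :: "nat \<Rightarrow> real \<Rightarrow> complex" where
  "polygon_boundary g s = cis (2 * pi * s / real (4 * g))"

inductive side_pairing :: "nat \<Rightarrow> complex \<Rightarrow> complex \<Rightarrow> bool" for g :: nat where
  side_a: "\<lbrakk>j < g; 0 \<le> t; t \<le> 1\<rbrakk> \<Longrightarrow>
     side_pairing g (polygon_boundary g (real (4 * j) + t))
                    (polygon_boundary g (real (4 * j) + 3 - t))"
| side_b: "\<lbrakk>j < g; 0 \<le> t; t \<le> 1\<rbrakk> \<Longrightarrow>
     side_pairing g (polygon_boundary g (real (4 * j) + 1 + t))
                    (polygon_boundary g (real (4 * j) + 4 - t))"

text \<open>\<open>S\<close>, with the subspace topology, is homeomorphic to that identification space.\<close>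

definition closed_orientable_surface :: "nat \<Rightarrow> 'a::topological_space set \<Rightarrow> bool" where
  "closed_orientable_surface g S \<longleftrightarrow>
     (\<exists>f. quotient_map (top_of_set (cball (0::complex) 1)) (top_of_set S) f \<and>
          (\<forall>x\<in>cball 0 1. \<forall>y\<in>cball 0 1. f x = f y \<longleftrightarrow> equivclp (side_pairing g) x y))"

text \<open>Every closed orientable surface embeds in three-dimensional Euclidean space, so nothing
  is lost by taking the surface to be a subset of it.\<close>

definition surface_group :: "nat \<Rightarrow> ('a, 'b) monoid_scheme \<Rightarrow> bool" where
  "surface_group g G \<longleftrightarrow>
     2 \<le> g \<and> group G \<and>
     (\<exists>(S :: (real ^ 3) set) x. closed_orientable_surface g S \<and> x \<in> S \<and>
        G \<cong> fundamental_group S x)"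

definition polysurface_group :: "('a, 'b) monoid_scheme \<Rightarrow> nat \<Rightarrow> (nat \<Rightarrow> 'a set) \<Rightarrow> bool" where
  "polysurface_group G n F \<longleftrightarrow>
     group G \<and> F 0 = {\<one>\<^bsub>G\<^esub>} \<and> F n = carrier G \<and>
     (\<forall>i\<le>n. F i \<lhd> G) \<and>
     (\<forall>i<n. F i \<subset> F (Suc i)) \<and>
     (\<forall>i<n. \<exists>g. surface_group g ((G\<lparr>carrier := F (Suc i)\<rparr>) Mod F i))"

definition group_exponent :: "('a, 'b) monoid_scheme \<Rightarrow> nat" where
  "group_exponent A = (LEAST k. 0 < k \<and> (\<forall>x\<in>carrier A. x [^]\<^bsub>A\<^esub> k = \<one>\<^bsub>A\<^esub>))"

definition minimal_generating_set :: "('a, 'b) monoid_scheme \<Rightarrow> 'a set \<Rightarrow> bool" where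
  "minimal_generating_set A R \<longleftrightarrow>
     R \<subseteq> carrier A \<and> finite R \<and> generate A R = carrier A \<and>
     (\<forall>T. T \<subseteq> carrier A \<and> finite T \<and> generate A T = carrier A \<longrightarrow> card R \<le> card T)"

text \<open>An extension \<open>1 \<rightarrow> A \<rightarrow> E \<rightarrow> Q \<rightarrow> 1\<close>, given by the maps \<open>\<iota>\<close> and \<open>\<phi>\<close>.\<close>

definition group_extension ::
  "('a, 'k) monoid_scheme \<Rightarrow> ('a \<Rightarrow> 'e) \<Rightarrow> ('e, 'l) monoid_scheme \<Rightarrow> ('e \<Rightarrow> 'q)
     \<Rightarrow> ('q, 'm) monoid_scheme \<Rightarrow> bool" where
  "group_extension A \<iota> E \<phi> Q \<longleftrightarrow>
     group A \<and> group E \<and> group Q \<and>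
     \<iota> \<in> hom A E \<and> inj_on \<iota> (carrier A) \<and>
     \<phi> \<in> hom E Q \<and> \<phi> ` carrier E = carrier Q \<and>
     \<iota> ` carrier A = kernel E Q \<phi>"

definition central_extension ::
  "('a, 'k) monoid_scheme \<Rightarrow> ('a \<Rightarrow> 'e) \<Rightarrow> ('e, 'l) monoid_scheme \<Rightarrow> ('e \<Rightarrow> 'q)
     \<Rightarrow> ('q, 'm) monoid_scheme \<Rightarrow> bool" where
  "central_extension A \<iota> E \<phi> Q \<longleftrightarrow>
     group_extension A \<iota> E \<phi> Q \<and>
     (\<forall>a\<in>carrier A. \<forall>x\<in>carrier E. \<iota> a \<otimes>\<^bsub>E\<^esub> x = x \<otimes>\<^bsub>E\<^esub> \<iota> a)"

definition trivial_extension ::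
  "('a, 'k) monoid_scheme \<Rightarrow> ('a \<Rightarrow> 'e) \<Rightarrow> ('e, 'l) monoid_scheme \<Rightarrow> ('e \<Rightarrow> 'q)
     \<Rightarrow> ('q, 'm) monoid_scheme \<Rightarrow> bool" where
  "trivial_extension A \<iota> E \<phi> Q \<longleftrightarrow>
     group_extension A \<iota> E \<phi> Q \<and>
     (\<exists>\<psi>\<in>iso E (A \<times>\<times> Q).
        (\<forall>a\<in>carrier A. \<psi> (\<iota> a) = (a, \<one>\<^bsub>Q\<^esub>)) \<and>
        (\<forall>x\<in>carrier E. snd (\<psi> x) = \<phi> x))"

end

theory Submission
  imports Defs
begin

text \<open>The index of a normalizer is the number of conjugates of the subgroup.  A conjugate of
  \<open>i(G\<^sub>1')\<close> by \<open>\<gamma>\<close> is a lift of the conjugate of \<open>G\<^sub>1'\<close> by \<open>\<phi>(\<gamma>)\<close>.  The latter is the kernel of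
  a homomorphism from \<open>G\<^sub>1\<close> to \<open>G\<^sub>1/G\<^sub>1'\<close>, so, \<open>G\<^sub>1\<close> having \<open>2g\<^sub>1\<close> generators, there are at
  most \<open>k\<close> to the power \<open>2g\<^sub>1\<close> of them, where \<open>k\<close> is the index of \<open>G\<^sub>1'\<close>.  By Schreier's
  argument \<open>G\<^sub>1'\<close> has \<open>2g\<^sub>1k\<close> generators, so each conjugate has at most \<open>|A|\<close> to the power
  \<open>2g\<^sub>1k\<close> lifts.

  The fundamental group of a \<open>4g\<close>-gon with sides identified in pairs is generated by the \<open>2g\<close> loops
  which run through the disc to a corner of one side and return from the identified corner of its
  partner.  This rests on two deformations compatible with the identifications: pushing a
  punctured disc out to its boundary circle, and collapsing neighbourhoods of the corners on that
  circle.  They cut any path, up to homotopy, into pieces that lift to the disc.\<close>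

section \<open>Counting conjugates\<close>

lemma hom_eq_on_generate:
  fixes M :: "('a, 'b) monoid_scheme" and N :: "('c, 'd) monoid_scheme"
  assumes "group M" "group N" "f \<in> hom M N" "h \<in> hom M N" "B \<subseteq> carrier M"
    and eq: "\<And>x. x \<in> B \<Longrightarrow> f x = h x" and y: "y \<in> generate M B"
  shows "f y = h y"
proof -
  interpret M: group M by fact
  interpret f: group_hom M N f using assms by (simp add: group_hom_def group_hom_axioms_def)
  interpret h: group_hom M N h using assms by (simp add: group_hom_def group_hom_axioms_def)
  show ?thesis
    using y
  proof induction
    case (inv x)
    then have "x \<in> carrier M" using assms(5) by blast
    then show ?case using eq[OF inv] by simp
  next
    case (eng x y)
    then show ?case using M.generate_in_carrier[OF assms(5)] by simp
  qed (use eq in simp_all)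
qed

lemma finite_rcosets_pos:
  fixes G :: "('a, 'b) monoid_scheme"
  assumes "finite (rcosets\<^bsub>G\<^esub> N)" "group G"
  shows "0 < card (rcosets\<^bsub>G\<^esub> N)"
proof -
  have "N #>\<^bsub>G\<^esub> \<one>\<^bsub>G\<^esub> \<in> rcosets\<^bsub>G\<^esub> N"
    using assms(2) by (auto simp: RCOSETS_def intro!: bexI[of _ "\<one>\<^bsub>G\<^esub>"] monoid.one_closed group.is_monoid)
  then show ?thesis using assms(1) card_gt_0_iff by blast
qed

text \<open>Schreier's argument: with coset representatives \<open>r\<close> (and \<open>\<one>\<close> representing \<open>N\<close>), the elements
  \<open>r x t\<^sup>-\<^sup>1\<close>, where \<open>t\<close> represents the coset of \<open>r x\<close>, generate \<open>N\<close>.\<close>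

lemma (in group) finite_index_subgroup_generators:
  assumes B: "B \<subseteq> carrier G" "finite B" "generate G B = carrier G"
    and N: "subgroup N G" and fin: "finite (rcosets N)"
  shows "\<exists>Y\<subseteq>N. finite Y \<and> card Y \<le> card (rcosets N) * card B \<and> generate G Y = N"
proof -
  define rep where "rep C = (if C = N then \<one> else SOME y. y \<in> C)" for C
  define t where "t x = rep (N #> x)" for x
  define T where "T = rep ` (rcosets N)"
  define s where "s r x = r \<otimes> x \<otimes> inv (t (r \<otimes> x))" for r x
  define Y where "Y = (\<lambda>(r, x). s r x) ` (T \<times> B)"
  interpret N: subgroup N G by fact
  have rep_in: "rep C \<in> C" if "C \<in> rcosets N" for C
    using that subgroup.rcosets_non_empty[OF N that] someI_ex[of "\<lambda>y. y \<in> C"]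
    by (auto simp: rep_def)
  have t_in: "t x \<in> N #> x" if "x \<in> carrier G" for x
    unfolding t_def using rep_in that by (auto simp: RCOSETS_def)
  have tc: "t x \<in> carrier G" if "x \<in> carrier G" for x
    using t_in[OF that] that r_coset_subset_G[OF N.subset] by blast
  have coset_t: "N #> t x = N #> x" if "x \<in> carrier G" for x
    using repr_independence[OF t_in[OF that] that N] by simp
  have T_iff: "T = t ` carrier G"
    unfolding T_def t_def RCOSETS_def by auto
  have Tc: "T \<subseteq> carrier G" using T_iff tc by auto
  have tT: "t r = r" if "r \<in> T" for r
    using that T_iff coset_t by (auto simp: t_def)
  have t_mult: "t (t x \<otimes> y) = t (x \<otimes> y)" if "x \<in> carrier G" "y \<in> carrier G" for x y
  proof -
    have "N #> (t x \<otimes> y) = (N #> t x) #> y" "N #> (x \<otimes> y) = (N #> x) #> y"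
      using that tc coset_mult_assoc[OF N.subset] by simp_all
    then have "N #> (t x \<otimes> y) = N #> (x \<otimes> y)" using coset_t[OF that(1)] by simp
    then show ?thesis by (simp only: t_def)
  qed
  have sN: "s r x \<in> N" if "r \<in> carrier G" "x \<in> carrier G" for r x
  proof -
    have "r \<otimes> x \<in> carrier G" using that by simp
    then obtain n where n: "n \<in> N" "t (r \<otimes> x) = n \<otimes> (r \<otimes> x)"
      using t_in by (auto simp: r_coset_def)
    have "z \<otimes> inv (n \<otimes> z) = inv n" if "z \<in> carrier G" for z
      using that N.mem_carrier[OF n(1)] by (simp add: inv_mult_group m_assoc[symmetric])
    then have "s r x = inv n"
      using n(2) that by (simp add: s_def)
    then show ?thesis using n by simp
  qed
  have YN: "Y \<subseteq> N" using sN Tc B(1) by (auto simp: Y_def)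
  then have Yc: "Y \<subseteq> carrier G" using N.subset by auto
  interpret Y: subgroup "generate G Y" G using generate_is_subgroup[OF Yc] .
  have key: "\<forall>r\<in>T. s r g \<in> generate G Y" if "g \<in> generate G B" for g
    using that
  proof induction
    case one
    show ?case using Tc tT by (auto simp: s_def subset_iff)
  next
    case (incl x)
    then show ?case by (auto simp: Y_def intro!: generate.incl)
  next
    case (inv x)
    show ?case
    proof
      fix r assume r: "r \<in> T"
      have c: "x \<in> carrier G" "r \<in> carrier G" using r Tc inv B(1) by auto
      define q where "q = t (r \<otimes> inv x)"
      have q: "q \<in> T" "q \<in> carrier G" using c tc by (auto simp: q_def T_iff)
      have "t (q \<otimes> x) = t (r \<otimes> inv x \<otimes> x)" unfolding q_def using c by (intro t_mult) auto
      then have "t (q \<otimes> x) = r" using c tT[OF r] by (simp add: m_assoc)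
      then have "s r (inv x) = inv (s q x)"
        using c q by (simp add: s_def q_def inv_mult_group m_assoc)
      moreover have "s q x \<in> generate G Y"
        using q inv by (auto simp: Y_def intro!: generate.incl)
      ultimately show "s r (inv x) \<in> generate G Y" by simp
    qed
  next
    case (eng g h)
    show ?case
    proof
      fix r assume r: "r \<in> T"
      have c: "g \<in> carrier G" "h \<in> carrier G" "r \<in> carrier G" 
        using r Tc eng generate_in_carrier[OF B(1)] by auto
      define q where "q = t (r \<otimes> g)"
      have q: "q \<in> T" "q \<in> carrier G" using c tc by (auto simp: q_def T_iff)
      have "t (q \<otimes> h) = t (r \<otimes> (g \<otimes> h))"
        unfolding q_def using c t_mult[of "r \<otimes> g" h] by (simp add: m_assoc)
      moreover have "inv q \<otimes> (q \<otimes> z) = z" if "z \<in> carrier G" for z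
        using that q by (simp add: m_assoc[symmetric])
      ultimately have "s r (g \<otimes> h) = s r g \<otimes> s q h"
        using c q tc by (simp add: s_def q_def[symmetric] m_assoc)
      then show "s r (g \<otimes> h) \<in> generate G Y" using eng r q by simp
    qed
  qed
  have NR: "N \<in> rcosets N" using N by (metis coset_mult_one N.subset one_closed rcosetsI)
  have one_T: "\<one> \<in> T" using NR by (auto simp: T_def rep_def intro!: image_eqI[of _ _ N])
  have "N \<subseteq> generate G Y"
  proof
    fix n assume n: "n \<in> N"
    then have "t n = \<one>" using N.mem_carrier coset_join2[OF _ N n] by (simp add: t_def rep_def)
    then have "s \<one> n = n" using n by (simp add: s_def)
    moreover have "s \<one> n \<in> generate G Y" using key[of n] n B(3) one_T by auto
    ultimately show "n \<in> generate G Y" by simp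
  qed
  moreover have "generate G Y \<subseteq> N" using generate_subgroup_incl[OF YN N] .
  moreover have "finite T" "card T \<le> card (rcosets N)" using fin by (auto simp: T_def card_image_le)
  moreover have "card Y \<le> card T * card B"
    unfolding Y_def using \<open>finite T\<close> B(2) by (metis card_cartesian_product card_image_le finite_SigmaI)
  ultimately show ?thesis
    using YN B(2) by (intro exI[of _ Y]) (auto simp: Y_def intro: order_trans[OF _ mult_right_mono])
qed

lemma card_image_le_code:
  assumes "finite C" and "code ` D \<subseteq> C"
    and eq: "\<And>x y. x \<in> D \<Longrightarrow> y \<in> D \<Longrightarrow> code x = code y \<Longrightarrow> f x = f y"
  shows "finite (f ` D) \<and> card (f ` D) \<le> card C"
proof -
  define s where "s c = (SOME x. x \<in> D \<and> code x = c)" for c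
  have "f x \<in> (\<lambda>c. f (s c)) ` C" if "x \<in> D" for x
  proof (rule image_eqI)
    have "s (code x) \<in> D \<and> code (s (code x)) = code x"
      unfolding s_def by (rule someI[of _ x]) (use that in simp)
    then show "f x = f (s (code x))" using eq that by metis
  qed (use assms(2) that in auto)
  then have "f ` D \<subseteq> (\<lambda>c. f (s c)) ` C" by auto
  then show ?thesis
    using assms(1) by (meson card_image_le card_mono finite_imageI finite_subset order_trans)
qed

definition conjugate :: "('a, 'b) monoid_scheme \<Rightarrow> 'a \<Rightarrow> 'a set \<Rightarrow> 'a set" where
  "conjugate G g H = (\<lambda>h. g \<otimes>\<^bsub>G\<^esub> h \<otimes>\<^bsub>G\<^esub> inv\<^bsub>G\<^esub> g) ` H"

lemma (in group) conjugate_mult: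
  assumes "g \<in> carrier G" "h \<in> carrier G" "H \<subseteq> carrier G"
  shows "conjugate G (g \<otimes> h) H = conjugate G g (conjugate G h H)"
  unfolding conjugate_def image_image
  using assms by (intro image_cong) (auto simp: inv_mult_group m_assoc subset_iff)

lemma (in group) conjugate_one: "H \<subseteq> carrier G \<Longrightarrow> conjugate G \<one> H = H"
  unfolding conjugate_def by (auto simp: subset_iff image_iff)

lemma (in group) card_rcosets_normalizer:
  assumes "H \<subseteq> carrier G" and "finite ((\<lambda>g. conjugate G g H) ` carrier G)"
  shows "finite (rcosets (normalizer G H))"
    and "card (rcosets (normalizer G H)) = card ((\<lambda>g. conjugate G g H) ` carrier G)"
proof -
  define act where "act = (\<lambda>g. \<lambda>H \<in> {H. H \<subseteq> carrier G}. g <# H #> inv g)"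
  interpret group_action G "{H. H \<subseteq> carrier G}" act
    unfolding act_def by (rule action_by_conjugation_on_power_set)
  have "orbit G act H = (\<lambda>g. conjugate G g H) ` carrier G"
    using assms(1)
    by (auto simp: orbit_def act_def conjugate_def l_coset_def r_coset_def)
  then have "bij_betw (\<lambda>R. act (inv (SOME h. h \<in> R)) H) (rcosets (normalizer G H))
      ((\<lambda>g. conjugate G g H) ` carrier G)"
    using orbit_stab_fun_is_bij[of H] assms(1) by (simp add: normalizer_def act_def)
  then show "finite (rcosets (normalizer G H))"
    and "card (rcosets (normalizer G H)) = card ((\<lambda>g. conjugate G g H) ` carrier G)"
    using assms(2) bij_betw_finite bij_betw_same_card by blast+
qed

lemma (in group) card_conjugates_of_normal:
  assumes K: "K \<lhd> G" and B: "B \<subseteq> K" "finite B" "generate G B = K"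
    and N: "N \<lhd> G\<lparr>carrier := K\<rparr>" and fin: "finite (rcosets\<^bsub>G\<lparr>carrier := K\<rparr>\<^esub> N)"
  shows "finite ((\<lambda>c. conjugate G c N) ` carrier G) \<and>
    card ((\<lambda>c. conjugate G c N) ` carrier G) \<le> card (rcosets\<^bsub>G\<lparr>carrier := K\<rparr>\<^esub> N) ^ card B"
proof -
  let ?K = "G\<lparr>carrier := K\<rparr>"
  let ?Q = "?K Mod N"
  interpret K: normal K G by fact
  interpret N: normal N ?K by fact
  have NK: "N \<subseteq> K" using N.subset by simp
  interpret N: subgroup N G using incl_subgroup[OF K.subgroup_axioms N.subgroup_axioms] .
  interpret Q: group ?Q by (rule N.factorgroup_is_group)
  have conjK: "inv c \<otimes> x \<otimes> c \<in> K" if "c \<in> carrier G" "x \<in> K" for c x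
    using K.inv_op_closed1[OF that] .
  define h where "h c x = N #> (inv c \<otimes> x \<otimes> c)" for c x
  have hom: "h c \<in> hom ?K ?Q" if c: "c \<in> carrier G" for c
  proof -
    have "(\<lambda>x. inv c \<otimes> x \<otimes> c) \<in> hom ?K ?K"
    proof (rule homI)
      fix x y assume "x \<in> carrier ?K" "y \<in> carrier ?K"
      then have xy: "x \<in> carrier G" "y \<in> carrier G" using K.subset by auto
      have "c \<otimes> (inv c \<otimes> z) = z" if "z \<in> carrier G" for z
        using that c by (simp add: m_assoc[symmetric])
      then show "inv c \<otimes> (x \<otimes>\<^bsub>?K\<^esub> y) \<otimes> c = inv c \<otimes> x \<otimes> c \<otimes>\<^bsub>?K\<^esub> (inv c \<otimes> y \<otimes> c)"
        using c xy by (simp add: m_assoc)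
    qed (use c conjK in auto)
    from Group.hom_compose[OF this N.r_coset_hom_Mod] show ?thesis
      by (simp add: comp_def h_def[abs_def] r_coset_def)
  qed
  have ker: "conjugate G c N = {x \<in> K. h c x = N}" if c: "c \<in> carrier G" for c
  proof (intro equalityI subsetI)
    fix y assume "y \<in> conjugate G c N"
    then obtain x where x: "x \<in> N" "y = c \<otimes> x \<otimes> inv c" by (auto simp: conjugate_def)
    have xK: "x \<in> K" "x \<in> carrier G" using x NK N.mem_carrier by auto
    have "inv c \<otimes> y \<otimes> c = x" using xK c x by (simp add: m_assoc[symmetric]) (simp add: m_assoc)
    moreover have "y \<in> K" using K.inv_op_closed2[OF c xK(1)] x by simp
    ultimately show "y \<in> {x \<in> K. h c x = N}"
      using x coset_join2[OF xK(2) N.subgroup_axioms] by (simp add: h_def)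
  next
    fix y assume y: "y \<in> {x \<in> K. h c x = N}"
    let ?x = "inv c \<otimes> y \<otimes> c"
    have "?x \<in> N" using y conjK[OF c] K.subset coset_join1[of N ?x] N.subgroup_axioms
      by (auto simp: h_def)
    moreover have "y = c \<otimes> ?x \<otimes> inv c"
      using y c K.subset by (simp add: m_assoc[symmetric] subset_iff) (simp add: m_assoc subset_iff)
    ultimately show "y \<in> conjugate G c N" by (auto simp: conjugate_def)
  qed
  have gK: "generate ?K B = carrier ?K"
    using B generate_consistent[OF B(1) K.subgroup_axioms] by simp
  have "finite ((\<lambda>c. conjugate G c N) ` carrier G) \<and>
      card ((\<lambda>c. conjugate G c N) ` carrier G) \<le> card (PiE B (\<lambda>_. carrier ?Q))"
  proof (rule card_image_le_code[where code = "\<lambda>c. restrict (h c) B"])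
    show "(\<lambda>c. restrict (h c) B) ` carrier G \<subseteq> PiE B (\<lambda>_. carrier ?Q)"
    proof (rule image_subsetI)
      fix c assume c: "c \<in> carrier G"
      have "h c x \<in> carrier ?Q" if "x \<in> B" for x
        using hom_in_carrier[OF hom[OF c], of x] that B(1) by auto
      then show "restrict (h c) B \<in> PiE B (\<lambda>_. carrier ?Q)" by auto
    qed
    show "finite (PiE B (\<lambda>_. carrier ?Q))"
      using B fin by (simp add: finite_PiE FactGroup_def)
    fix c d assume cd: "c \<in> carrier G" "d \<in> carrier G" and eq: "restrict (h c) B = restrict (h d) B"
    have "h c x = h d x" if "x \<in> K" for x
    proof (rule hom_eq_on_generate[OF _ _ hom[OF cd(1)] hom[OF cd(2)]])
      show "h c x = h d x" if "x \<in> B" for x using eq that by (metis restrict_apply')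
    qed (use B that gK K.subgroup_is_group Q.is_group is_group N.is_group in auto)
    then show "conjugate G c N = conjugate G d N" using ker cd by auto
  qed
  then show ?thesis using B by (simp add: card_PiE FactGroup_def)
qed

lemma card_conjugates_of_section:
  fixes \<Gamma> :: "('e, 'l) monoid_scheme" and G :: "('g, 'm) monoid_scheme"
  assumes \<phi>: "group_hom \<Gamma> G \<phi>" and N: "subgroup N G"
    and Y: "Y \<subseteq> N" "finite Y" "generate G Y = N"
    and i: "i \<in> hom (G\<lparr>carrier := N\<rparr>) \<Gamma>" "\<And>x. x \<in> N \<Longrightarrow> \<phi> (i x) = x"
    and fiber: "\<And>y. y \<in> N \<Longrightarrow> finite {x \<in> carrier \<Gamma>. \<phi> x = y} \<and> card {x \<in> carrier \<Gamma>. \<phi> x = y} \<le> a"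
  defines "D \<equiv> {d \<in> carrier \<Gamma>. conjugate G (\<phi> d) N = N}"
  shows "finite ((\<lambda>d. conjugate \<Gamma> d (i ` N)) ` D) \<and> card ((\<lambda>d. conjugate \<Gamma> d (i ` N)) ` D) \<le> a ^ card Y"
proof -
  interpret \<phi>: group_hom \<Gamma> G \<phi> by fact
  interpret N: subgroup N G by fact
  let ?N = "G\<lparr>carrier := N\<rparr>"
  have gN: "group ?N" using \<phi>.subgroup_imp_group N.subgroup_axioms by blast
  define j where "j d x = d \<otimes>\<^bsub>\<Gamma>\<^esub> i (inv\<^bsub>G\<^esub> (\<phi> d) \<otimes>\<^bsub>G\<^esub> x \<otimes>\<^bsub>G\<^esub> \<phi> d) \<otimes>\<^bsub>\<Gamma>\<^esub> inv\<^bsub>\<Gamma>\<^esub> d" for d x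
  let ?c = "\<lambda>d x. inv\<^bsub>G\<^esub> (\<phi> d) \<otimes>\<^bsub>G\<^esub> x \<otimes>\<^bsub>G\<^esub> \<phi> d"
  have iN: "i x \<in> carrier \<Gamma>" if "x \<in> N" for x using i(1) that by (auto simp: hom_def)
  have i_mult: "i (x \<otimes>\<^bsub>G\<^esub> y) = i x \<otimes>\<^bsub>\<Gamma>\<^esub> i y" if "x \<in> N" "y \<in> N" for x y
    using i(1) that by (auto simp: hom_def)
  have Dc: "d \<in> carrier \<Gamma>" "\<phi> d \<in> carrier G" if "d \<in> D" for d using that by (auto simp: D_def)
  have c_conj: "?c d (\<phi> d \<otimes>\<^bsub>G\<^esub> x \<otimes>\<^bsub>G\<^esub> inv\<^bsub>G\<^esub> (\<phi> d)) = x" if "d \<in> D" "x \<in> carrier G" for d x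
    using that Dc[OF that(1)] by (simp add: \<phi>.H.m_assoc[symmetric]) (simp add: \<phi>.H.m_assoc)
  have c_bij: "?c d ` N = N" if d: "d \<in> D" for d
  proof -
    have "N = conjugate G (\<phi> d) N" using d by (simp add: D_def)
    then have "?c d ` N = (\<lambda>x. ?c d (\<phi> d \<otimes>\<^bsub>G\<^esub> x \<otimes>\<^bsub>G\<^esub> inv\<^bsub>G\<^esub> (\<phi> d))) ` N"
      unfolding conjugate_def by (metis (no_types, lifting) image_cong image_image)
    also have "\<dots> = N" using c_conj[OF d] N.mem_carrier by simp
    finally show ?thesis .
  qed
  have j_image: "j d ` N = conjugate \<Gamma> d (i ` N)" if d: "d \<in> D" for d
  proof -
    have "j d ` N = (\<lambda>x. d \<otimes>\<^bsub>\<Gamma>\<^esub> i x \<otimes>\<^bsub>\<Gamma>\<^esub> inv\<^bsub>\<Gamma>\<^esub> d) ` (?c d ` N)"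
      by (simp add: image_image j_def)
    then show ?thesis unfolding c_bij[OF d] by (simp add: image_image conjugate_def)
  qed
  have j_hom: "j d \<in> hom ?N \<Gamma>" if d: "d \<in> D" for d
  proof (rule homI)
    fix x assume "x \<in> carrier ?N"
    then have "?c d x \<in> N" using c_bij[OF d] by auto
    then show "j d x \<in> carrier \<Gamma>" using iN Dc[OF d] by (simp add: j_def)
  next
    fix x y assume "x \<in> carrier ?N" "y \<in> carrier ?N"
    then have xy: "x \<in> N" "y \<in> N" "x \<in> carrier G" "y \<in> carrier G" using N.mem_carrier by auto
    have xy': "?c d x \<in> N" "?c d y \<in> N" using c_bij[OF d] xy by auto
    have *: "\<phi> d \<otimes>\<^bsub>G\<^esub> (inv\<^bsub>G\<^esub> (\<phi> d) \<otimes>\<^bsub>G\<^esub> z) = z" if "z \<in> carrier G" for z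
      using that Dc[OF d] by (simp add: \<phi>.H.m_assoc[symmetric])
    have **: "inv\<^bsub>\<Gamma>\<^esub> d \<otimes>\<^bsub>\<Gamma>\<^esub> (d \<otimes>\<^bsub>\<Gamma>\<^esub> z) = z" if "z \<in> carrier \<Gamma>" for z
      using that Dc[OF d] by (simp add: \<phi>.G.m_assoc[symmetric])
    have "?c d (x \<otimes>\<^bsub>G\<^esub> y) = ?c d x \<otimes>\<^bsub>G\<^esub> ?c d y"
      using Dc(2)[OF d] xy * by (simp add: \<phi>.H.m_assoc)
    then have "i (?c d (x \<otimes>\<^bsub>G\<^esub> y)) = i (?c d x) \<otimes>\<^bsub>\<Gamma>\<^esub> i (?c d y)" using i_mult xy' by simp
    moreover have "d \<otimes>\<^bsub>\<Gamma>\<^esub> (u \<otimes>\<^bsub>\<Gamma>\<^esub> v) \<otimes>\<^bsub>\<Gamma>\<^esub> inv\<^bsub>\<Gamma>\<^esub> d = 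
       d \<otimes>\<^bsub>\<Gamma>\<^esub> u \<otimes>\<^bsub>\<Gamma>\<^esub> inv\<^bsub>\<Gamma>\<^esub> d \<otimes>\<^bsub>\<Gamma>\<^esub> (d \<otimes>\<^bsub>\<Gamma>\<^esub> v \<otimes>\<^bsub>\<Gamma>\<^esub> inv\<^bsub>\<Gamma>\<^esub> d)"
      if "u \<in> carrier \<Gamma>" "v \<in> carrier \<Gamma>" for u v
      using that Dc[OF d] ** by (simp add: \<phi>.G.m_assoc)
    ultimately show "j d (x \<otimes>\<^bsub>?N\<^esub> y) = j d x \<otimes>\<^bsub>\<Gamma>\<^esub> j d y"
      using iN xy' unfolding j_def by simp
  qed
  have j_section: "\<phi> (j d x) = x" if d: "d \<in> D" and x: "x \<in> N" for d x
  proof -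
    have "?c d x \<in> N" using c_bij[OF d] x by auto
    then have "\<phi> (j d x) = \<phi> d \<otimes>\<^bsub>G\<^esub> ?c d x \<otimes>\<^bsub>G\<^esub> inv\<^bsub>G\<^esub> (\<phi> d)"
      using iN Dc[OF d] i(2) by (simp add: j_def)
    also have "\<dots> = x"
      using Dc[OF d] x by (simp add: \<phi>.H.m_assoc[symmetric]) (simp add: \<phi>.H.m_assoc)
    finally show ?thesis .
  qed
  have gY: "generate ?N Y = carrier ?N"
    using Y \<phi>.H.generate_consistent[OF Y(1) N.subgroup_axioms] by simp
  let ?P = "PiE Y (\<lambda>y. {x \<in> carrier \<Gamma>. \<phi> x = y})"
  have "finite ((\<lambda>d. conjugate \<Gamma> d (i ` N)) ` D) \<and> card ((\<lambda>d. conjugate \<Gamma> d (i ` N)) ` D) \<le> card ?P"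
  proof (rule card_image_le_code[where code = "\<lambda>d. restrict (j d) Y"])
    show "finite ?P" using Y fiber by (intro finite_PiE) auto
    show "(\<lambda>d. restrict (j d) Y) ` D \<subseteq> ?P"
    proof (rule image_subsetI)
      fix d assume d: "d \<in> D"
      have "j d y \<in> carrier \<Gamma> \<and> \<phi> (j d y) = y" if "y \<in> Y" for y
        using hom_in_carrier[OF j_hom[OF d], of y] j_section[OF d, of y] that Y(1) by auto
      then show "restrict (j d) Y \<in> ?P" by auto
    qed
    fix d d' assume dd: "d \<in> D" "d' \<in> D" and eq: "restrict (j d) Y = restrict (j d') Y"
    have "j d x = j d' x" if "x \<in> N" for x
    proof (rule hom_eq_on_generate[OF gN _ j_hom[OF dd(1)] j_hom[OF dd(2)]])
      show "j d x = j d' x" if "x \<in> Y" for x using eq that by (metis restrict_apply')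
    qed (use Y that gY \<phi>.G.is_group in auto)
    then have "j d ` N = j d' ` N" by simp
    then show "conjugate \<Gamma> d (i ` N) = conjugate \<Gamma> d' (i ` N)" using j_image dd by simp
  qed
  moreover have "card ?P \<le> a ^ card Y"
  proof -
    have "card ?P = (\<Prod>y\<in>Y. card {x \<in> carrier \<Gamma>. \<phi> x = y})" using Y by (simp add: card_PiE)
    also have "\<dots> \<le> (\<Prod>y\<in>Y. a)" using fiber Y(1) by (intro prod_mono) auto
    finally show ?thesis by simp
  qed
  ultimately show ?thesis by linarith
qed

lemma card_conjugates_of_lift:
  fixes \<Gamma> :: "('e, 'l) monoid_scheme" and G :: "('g, 'm) monoid_scheme"
  assumes \<phi>: "group_hom \<Gamma> G \<phi>"
    and K: "K \<lhd> G" and B: "B \<subseteq> K" "finite B" "generate G B = K"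
    and N: "N \<lhd> G\<lparr>carrier := K\<rparr>" and fin: "finite (rcosets\<^bsub>G\<lparr>carrier := K\<rparr>\<^esub> N)"
    and i: "i \<in> hom (G\<lparr>carrier := N\<rparr>) \<Gamma>" "\<And>x. x \<in> N \<Longrightarrow> \<phi> (i x) = x"
    and fiber: "\<And>y. y \<in> N \<Longrightarrow> finite {x \<in> carrier \<Gamma>. \<phi> x = y} \<and> card {x \<in> carrier \<Gamma>. \<phi> x = y} \<le> a"
    and a: "1 \<le> a"
  defines "k \<equiv> card (rcosets\<^bsub>G\<lparr>carrier := K\<rparr>\<^esub> N)"
  shows "finite ((\<lambda>d. conjugate \<Gamma> d (i ` N)) ` carrier \<Gamma>) \<and>
    card ((\<lambda>d. conjugate \<Gamma> d (i ` N)) ` carrier \<Gamma>) \<le> k ^ card B * a ^ (k * card B)"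
proof -
  let ?K = "G\<lparr>carrier := K\<rparr>"
  interpret \<phi>: group_hom \<Gamma> G \<phi> by fact
  interpret K: normal K G by fact
  interpret N: normal N ?K by fact
  have NG: "subgroup N G" using \<phi>.H.incl_subgroup[OF K.subgroup_axioms N.subgroup_axioms] .
  then have Nc: "N \<subseteq> carrier G" by (rule subgroup.subset)
  have gK: "generate ?K B = carrier ?K"
    using B \<phi>.H.generate_consistent[OF B(1) K.subgroup_axioms] by simp
  obtain Y where Y: "Y \<subseteq> N" "finite Y" "card Y \<le> k * card B" "generate ?K Y = N"
    using N.finite_index_subgroup_generators[OF _ B(2) gK N.subgroup_axioms fin] B(1) k_def by auto
  have "Y \<subseteq> K" using Y N.subset by auto
  then have gY: "generate G Y = N"
    using Y \<phi>.H.generate_consistent[OF _ K.subgroup_axioms] by simp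
  define P where "P = (\<lambda>c. conjugate G c N) ` carrier G"
  have P: "finite P" "card P \<le> k ^ card B"
    using \<phi>.H.card_conjugates_of_normal[OF K B N fin] by (simp_all add: P_def k_def)
  define D where "D = {d \<in> carrier \<Gamma>. conjugate G (\<phi> d) N = N}"
  define L where "L = (\<lambda>d. conjugate \<Gamma> d (i ` N)) ` D"
  have L: "finite L" "card L \<le> a ^ card Y"
    using card_conjugates_of_section[OF \<phi> NG Y(1,2) gY i fiber] by (simp_all add: D_def L_def)
  define s where "s p = (SOME d. d \<in> carrier \<Gamma> \<and> conjugate G (\<phi> d) N = p)" for p
  have iN: "i ` N \<subseteq> carrier \<Gamma>" using i(1) by (auto simp: hom_def)
  have "conjugate \<Gamma> d (i ` N) \<in> (\<Union>p\<in>P. conjugate \<Gamma> (s p) ` L)" if d: "d \<in> carrier \<Gamma>" for d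
  proof -
    define p where "p = conjugate G (\<phi> d) N"
    have pP: "p \<in> P" using d by (auto simp: P_def p_def)
    have s: "s p \<in> carrier \<Gamma>" "conjugate G (\<phi> (s p)) N = p"
      using someI[of "\<lambda>d. d \<in> carrier \<Gamma> \<and> conjugate G (\<phi> d) N = p" d] d by (auto simp: s_def p_def)
    define e where "e = inv\<^bsub>\<Gamma>\<^esub> (s p) \<otimes>\<^bsub>\<Gamma>\<^esub> d"
    have e: "e \<in> carrier \<Gamma>" "s p \<otimes>\<^bsub>\<Gamma>\<^esub> e = d"
      using s d by (simp_all add: e_def \<phi>.G.m_assoc[symmetric])
    have "conjugate G (\<phi> e) N = conjugate G (inv\<^bsub>G\<^esub> (\<phi> (s p))) (conjugate G (\<phi> d) N)"
      using s d Nc by (simp add: e_def \<phi>.H.conjugate_mult)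
    also have "\<dots> = conjugate G (inv\<^bsub>G\<^esub> (\<phi> (s p))) (conjugate G (\<phi> (s p)) N)"
      using s by (simp add: p_def)
    also have "\<dots> = N"
      using s(1) Nc by (simp add: \<phi>.H.conjugate_mult[symmetric] \<phi>.H.conjugate_one)
    finally have "e \<in> D" using e by (simp add: D_def)
    moreover have "conjugate \<Gamma> d (i ` N) = conjugate \<Gamma> (s p) (conjugate \<Gamma> e (i ` N))"
      using \<phi>.G.conjugate_mult[OF s(1) e(1) iN] e by simp
    ultimately show ?thesis using pP by (auto simp: L_def)
  qed
  then have sub: "(\<lambda>d. conjugate \<Gamma> d (i ` N)) ` carrier \<Gamma> \<subseteq> (\<Union>p\<in>P. conjugate \<Gamma> (s p) ` L)"
    by auto
  have "card (\<Union>p\<in>P. conjugate \<Gamma> (s p) ` L) \<le> (\<Sum>p\<in>P. card (conjugate \<Gamma> (s p) ` L))"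
    using P(1) by (rule card_UN_le)
  also have "\<dots> \<le> (\<Sum>p\<in>P. a ^ card Y)"
    using L by (intro sum_mono) (meson card_image_le order_trans)
  also have "\<dots> \<le> k ^ card B * a ^ (k * card B)"
    using P Y(3) a by (auto intro!: mult_mono power_increasing)
  finally have "card (\<Union>p\<in>P. conjugate \<Gamma> (s p) ` L) \<le> k ^ card B * a ^ (k * card B)" .
  moreover have "finite (\<Union>p\<in>P. conjugate \<Gamma> (s p) ` L)" using P L by auto
  ultimately show ?thesis
    using sub by (meson card_mono finite_subset order_trans)
qed

section \<open>Representations of the fundamental groupoid\<close>

text \<open>A functor from the fundamental groupoid of \<open>S\<close> to a group.\<close>

locale groupoid_rep = group M for M (structure) +
  fixes S :: "'s::real_normed_vector set" and w :: "(real \<Rightarrow> 's) \<Rightarrow> 'a"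
  assumes w_closed: "\<And>p. path p \<Longrightarrow> path_image p \<subseteq> S \<Longrightarrow> w p \<in> carrier M"
    and w_join: "\<And>p q. path p \<Longrightarrow> path_image p \<subseteq> S \<Longrightarrow> path q \<Longrightarrow> path_image q \<subseteq> S \<Longrightarrow>
      pathfinish p = pathstart q \<Longrightarrow> w (p +++ q) = w p \<otimes> w q"
    and w_homotopic: "\<And>p q. homotopic_paths S p q \<Longrightarrow> w p = w q"
begin

lemma w_linepath_same:
  assumes "a \<in> S"
  shows "w (linepath a a) = \<one>"
proof -
  have "w (linepath a a) = w (linepath a a +++ linepath a a)"
    using homotopic_paths_rid[of "linepath a a" S] assms by (intro w_homotopic[symmetric]) auto
  also have "\<dots> = w (linepath a a) \<otimes> w (linepath a a)" using assms by (intro w_join) auto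
  finally show ?thesis using w_closed[of "linepath a a"] assms by (metis l_cancel_one path_linepath
    path_image_linepath closed_segment_idem empty_subsetI insert_subset)
qed

lemma w_cong:
  assumes "path p" "path_image p \<subseteq> S" "\<And>t. t \<in> {0..1} \<Longrightarrow> p t = q t"
  shows "w p = w q"
  using assms by (intro w_homotopic homotopic_paths_eq) auto

lemma w_convex:
  fixes C :: "'c::real_normed_vector set"
  assumes "convex C" "continuous_on C f" "f ` C \<subseteq> S"
    and "path p" "path_image p \<subseteq> C" "path q" "path_image q \<subseteq> C"
    and "pathstart p = pathstart q" "pathfinish p = pathfinish q"
  shows "w (f \<circ> p) = w (f \<circ> q)"
proof (intro w_homotopic homotopic_paths_continuous_image)
  have "closed_segment (p t) (q t) \<subseteq> C" if "t \<in> {0..1}" for t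
    using assms that by (intro closed_segment_subset) (auto simp: path_image_def)
  then show "homotopic_paths C p q"
    using assms by (intro homotopic_paths_linear) simp_all
qed (use assms in auto)

lemma w_square:
  assumes h: "continuous_on ({0..1} \<times> {0..1}) h" "h ` ({0..1} \<times> {0..1}) \<subseteq> S"
  shows "w (\<lambda>t. h (t, 0)) \<otimes> w (\<lambda>t. h (1, t)) = w (\<lambda>t. h (0, t)) \<otimes> w (\<lambda>t. h (t, 1))"
proof -
  let ?C = "{0..1::real} \<times> {0..1::real}"
  have C: "convex ?C" by (intro convex_Times) auto
  have img: "path_image (linepath a b) \<subseteq> ?C" if "a \<in> ?C" "b \<in> ?C" for a b
    using that C by (simp add: closed_segment_subset)
  have p: "path (h \<circ> linepath a b)" "path_image (h \<circ> linepath a b) \<subseteq> S" if "a \<in> ?C" "b \<in> ?C" for a b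
    using img[OF that] h by (auto intro!: path_continuous_image continuous_on_subset[OF h(1)] 
      simp: path_image_compose)
  have join: "w (h \<circ> linepath a b) \<otimes> w (h \<circ> linepath b c) = w (h \<circ> (linepath a b +++ linepath b c))"
    if "a \<in> ?C" "b \<in> ?C" "c \<in> ?C" for a b c
    unfolding path_compose_join using that p
    by (intro w_join[symmetric]) (auto simp: pathfinish_compose pathstart_compose)
  have "w (h \<circ> (linepath (0,0) (1,0) +++ linepath (1,0) (1,1)))
      = w (h \<circ> (linepath (0,0) (0,1) +++ linepath (0,1) (1,1)))"
    by (intro w_convex[OF C h] subset_path_image_join img) simp_all
  then have "w (h \<circ> linepath (0,0) (1,0)) \<otimes> w (h \<circ> linepath (1,0) (1,1))
      = w (h \<circ> linepath (0,0) (0,1)) \<otimes> w (h \<circ> linepath (0,1) (1,1))"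
    using join by simp
  moreover have "h \<circ> linepath (0,0) (1,0) = (\<lambda>t. h (t, 0))" "h \<circ> linepath (1,0) (1,1) = (\<lambda>t. h (1, t))"
    "h \<circ> linepath (0,0) (0,1) = (\<lambda>t. h (0, t))" "h \<circ> linepath (0,1) (1,1) = (\<lambda>t. h (t, 1))"
    by (auto simp: linepath_def fun_eq_iff algebra_simps)
  ultimately show ?thesis by simp
qed

lemma w_in_subgroup_local:
  assumes H: "subgroup H M" and p: "path p" "path_image p \<subseteq> S"
    and loc: "\<And>x. x \<in> {0..1} \<Longrightarrow> \<exists>d>0. \<forall>a b. 0 \<le> a \<and> a \<le> x \<and> x \<le> b \<and> b \<le> 1 \<and> b - a < d
      \<longrightarrow> w (subpath a b p) \<in> H"
  shows "w p \<in> H"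
proof -
  interpret H: subgroup H M by fact
  define P where "P a b \<longleftrightarrow> (0 \<le> a \<and> b \<le> 1 \<longrightarrow> w (subpath a b p) \<in> H)" for a b
  have "P 0 1"
  proof (rule Bolzano)
    fix a b c :: real assume ab: "P a b" "P b c" "a \<le> b" "b \<le> c"
    show "P a c" unfolding P_def
    proof
      assume ac: "0 \<le> a \<and> c \<le> 1"
      have sub: "path (subpath u v p)" "path_image (subpath u v p) \<subseteq> S"
        if "u \<in> {0..1}" "v \<in> {0..1}" for u v
        using p that path_image_subpath_subset[of u v p] by auto
      have "w (subpath a c p) = w (subpath a b p +++ subpath b c p)"
        using p ab ac by (intro w_homotopic homotopic_paths_sym[OF homotopic_join_subpaths]) auto
      also have "\<dots> = w (subpath a b p) \<otimes> w (subpath b c p)"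
        using sub ab ac by (intro w_join) auto
      finally show "w (subpath a c p) \<in> H" using ab ac by (auto simp: P_def)
    qed
  next
    fix x :: real assume x: "0 \<le> x" "x \<le> 1"
    then obtain d where "d > 0" "\<And>a b. 0 \<le> a \<and> a \<le> x \<and> x \<le> b \<and> b \<le> 1 \<and> b - a < d
      \<longrightarrow> w (subpath a b p) \<in> H" using loc[of x] by auto
    then show "\<exists>d>0. \<forall>a b. a \<le> x \<and> x \<le> b \<and> b - a < d \<longrightarrow> P a b"
      unfolding P_def by blast
  qed simp
  then show ?thesis by (simp add: P_def)
qed

lemma w_in_subgroup_homotopy:
  assumes H: "subgroup H M"
    and h: "continuous_on ({0..1} \<times> T) h" "h ` ({0..1} \<times> T) \<subseteq> S"
    and h0: "\<And>z. z \<in> T \<Longrightarrow> h (0, z) = z"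
    and trace: "\<And>z. z \<in> T \<Longrightarrow> w (\<lambda>t. h (t, z)) \<in> H"
    and p: "path p" "path_image p \<subseteq> T" and end_in: "w (\<lambda>s. h (1, p s)) \<in> H"
  shows "w p \<in> H"
proof -
  interpret H: subgroup H M by fact
  have pT: "p s \<in> T" if "s \<in> {0..1}" for s using p that by (auto simp: path_image_def)
  have "T \<subseteq> S"
  proof
    fix z assume "z \<in> T"
    then have "h (0, z) \<in> S" using h(2) by force
    then show "z \<in> S" using h0 \<open>z \<in> T\<close> by simp
  qed
  have "continuous_on ({0..1} \<times> {0..1}) (\<lambda>(t, s). h (t, p s))"
  proof -
    have "continuous_on ({0..1} \<times> {0..1}) (\<lambda>x::real \<times> real. p (snd x))"
      using p(1) unfolding path_def
      by (rule continuous_on_compose2) (auto intro: continuous_intros)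
    then have "continuous_on ({0..1} \<times> {0..1}) (\<lambda>x::real \<times> real. (fst x, p (snd x)))"
      by (intro continuous_intros)
    then have "continuous_on ({0..1} \<times> {0..1}) (\<lambda>x::real \<times> real. h (fst x, p (snd x)))"
      by (rule continuous_on_compose2[OF h(1)]) (use pT in auto)
    then show ?thesis by (simp add: case_prod_unfold)
  qed
  from w_square[OF this] have
    "w (\<lambda>t. h (t, p 0)) \<otimes> w (\<lambda>t. h (1, p t)) = w (\<lambda>t. h (0, p t)) \<otimes> w (\<lambda>t. h (t, p 1))"
    using h(2) pT by (auto simp: image_subset_iff)
  moreover have "w p = w (\<lambda>t. h (0, p t))"
    using p \<open>T \<subseteq> S\<close> h0 pT by (intro w_cong) auto
  moreover have "w p \<in> carrier M" using p \<open>T \<subseteq> S\<close> by (intro w_closed) auto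
  ultimately have "w p = w (\<lambda>t. h (t, p 0)) \<otimes> w (\<lambda>t. h (1, p t)) \<otimes> inv (w (\<lambda>t. h (t, p 1)))"
    using trace[OF pT] by (simp add: m_assoc)
  then show ?thesis using trace[OF pT] end_in by simp
qed

end

lemma compact_quotient_homotopy:
  fixes c :: "'a::t2_space \<Rightarrow> 'b::metric_space" and k :: "real \<times> 'a \<Rightarrow> 'c::topological_space"
  assumes D: "compact D" "continuous_on D c" and k: "continuous_on ({0..1} \<times> D) k"
    and fib: "\<And>t s s'. t \<in> {0..1} \<Longrightarrow> s \<in> D \<Longrightarrow> s' \<in> D \<Longrightarrow> c s = c s' \<Longrightarrow> k (t, s) = k (t, s')"
  obtains h where "continuous_on ({0..1} \<times> c ` D) h"
    and "\<And>t s. t \<in> {0..1} \<Longrightarrow> s \<in> D \<Longrightarrow> h (t, c s) = k (t, s)"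
proof -
  define h where "h = (\<lambda>(t, y). k (t, SOME s. s \<in> D \<and> c s = y))"
  define q where "q = (\<lambda>x. (fst x :: real, c (snd x)))"
  have hk: "h (t, c s) = k (t, s)" if "t \<in> {0..1}" "s \<in> D" for t s
  proof -
    let ?s = "SOME s'. s' \<in> D \<and> c s' = c s"
    have "?s \<in> D \<and> c ?s = c s" 
      using that by (intro someI[of "\<lambda>s'. s' \<in> D \<and> c s' = c s" s]) simp
    then have "k (t, ?s) = k (t, s)" using that by (intro fib) auto
    then show ?thesis by (simp add: h_def)
  qed
  have q: "continuous_on ({0..1} \<times> D) q"
    unfolding q_def by (intro continuous_intros continuous_on_compose2[OF D(2)]) auto
  have qi: "q ` ({0..1} \<times> D) = {0..1} \<times> c ` D" by (force simp: q_def)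
  have "quotient_map (top_of_set ({0..1} \<times> D)) (top_of_set ({0..1} \<times> c ` D)) q"
    using q qi D(1) compact_Times[OF compact_Icc[of "0::real" 1] D(1)]
    by (intro T1_Spaces.continuous_imp_quotient_map)
      (auto simp: continuous_map_in_subtopology compact_space_subtopology
        intro!: Hausdorff_space_subtopology Hausdorff_space_euclidean)
  moreover have "continuous_map (top_of_set ({0..1} \<times> D)) euclidean (h \<circ> q)"
    using continuous_on_eq[OF k, of "h \<circ> q"] hk by (auto simp: q_def)
  ultimately have "continuous_on ({0..1} \<times> c ` D) h"
    using continuous_compose_quotient_map_eq continuous_map_iff_continuous by blast
  then show thesis using hk that by blast
qed

lemma path_lift_injective:
  fixes c :: "'a::topological_space \<Rightarrow> 'b::t2_space"
  assumes "compact T" "continuous_on T c" "inj_on c T" "path p" "path_image p \<subseteq> c ` T"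
  obtains q where "path q" "path_image q \<subseteq> T" "\<And>t. t \<in> {0..1} \<Longrightarrow> c (q t) = p t"
proof -
  obtain d where d: "homeomorphism T (c ` T) c d"
    using homeomorphism_compact[OF assms(1,2) refl assms(3)] by blast
  show thesis
  proof (rule that[of "d \<circ> p"])
    show "path (d \<circ> p)"
      using d assms by (intro path_continuous_image) (auto simp: homeomorphism_def intro: continuous_on_subset)
    show "path_image (d \<circ> p) \<subseteq> T" 
      using d assms(5) by (auto simp: path_image_compose homeomorphism_def)
    show "c ((d \<circ> p) t) = p t" if "t \<in> {0..1}" for t
    proof -
      have "p t \<in> c ` T" using assms(5) that by (auto simp: path_image_def)
      then show ?thesis using homeomorphism_apply2[OF d] by simp
    qed
  qed
qed

lemma path_avoids_closed_locally:
  fixes p :: "real \<Rightarrow> 'b::real_normed_vector"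
  assumes "path p" "closed C" "x \<in> {0..1}" "p x \<notin> C"
  shows "\<exists>d>0. \<forall>a b. 0 \<le> a \<and> a \<le> x \<and> x \<le> b \<and> b \<le> 1 \<and> b - a < d \<longrightarrow> path_image (subpath a b p) \<inter> C = {}"
proof -
  have "closedin (top_of_set {0..1}) ({0..1} \<inter> p -` C)"
    using assms by (simp add: path_def continuous_closedin_preimage)
  then have "closed ({0..1} \<inter> p -` C)" using closedin_closed_trans by blast
  then obtain d where d: "d > 0" "ball x d \<inter> ({0..1} \<inter> p -` C) = {}"
    using assms(3,4) open_contains_ball[of "- ({0..1} \<inter> p -` C)"] by blast
  have "path_image (subpath a b p) \<inter> C = {}" if "0 \<le> a \<and> a \<le> x \<and> x \<le> b \<and> b \<le> 1 \<and> b - a < d" for a b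
  proof -
    have "{a..b} \<subseteq> ball x d \<inter> {0..1}" using that by (auto simp: dist_real_def)
    then show ?thesis using d that by (auto simp: path_image_subpath)
  qed
  then show ?thesis using d(1) by (intro exI[of _ d] conjI allI impI)
qed

section \<open>Paths in a polygon with identified sides\<close>

lemma norm_polygon_boundary [simp]: "norm (polygon_boundary g s) = 1"
  by (simp add: polygon_boundary_def)

lemma continuous_on_polygon_boundary [continuous_intros]:
  "continuous_on A h \<Longrightarrow> continuous_on A (\<lambda>x. polygon_boundary g (h x))"
  unfolding polygon_boundary_def divide_inverse by (intro continuous_intros)

lemma polygon_boundary_surj:
  assumes "0 < g" "norm z = 1"
  obtains s where "0 \<le> s" "s < real (4 * g)" "polygon_boundary g s = z"
proof
  let ?s = "Arg2pi z * real (4 * g) / (2 * pi)"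
  have "0 \<le> Arg2pi z" "Arg2pi z < 2 * pi" using Arg2pi by auto
  then show "0 \<le> ?s" "?s < real (4 * g)" using assms(1) by (auto simp: field_simps)
  have "z = exp (\<i> * of_real (Arg2pi z))" using Arg2pi_eq[of z] assms(2) by simp
  then show "polygon_boundary g ?s = z"
    using assms(1) by (simp add: polygon_boundary_def cis_conv_exp)
qed

lemma side_pairing_norm:
  assumes "side_pairing g x y"
  shows "norm x = 1" "norm y = 1"
  using assms by (auto elim!: side_pairing.cases)

text \<open>Identified boundary points other than vertices have the same \<open>side_coord\<close>, and it determines
  their position on the sides \<open>4 * j\<close> and \<open>4 * j + 1\<close>.  All vertices get the value \<open>-1\<close>.\<close>

definition side_coord :: "real \<Rightarrow> real" where
  "side_coord s = (if s \<in> \<int> then - 1 else if \<lfloor>s\<rfloor> mod 4 < 2 then s else 2 * of_int \<lfloor>s\<rfloor> - 1 - s)"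

definition boundary_coord :: "nat \<Rightarrow> complex \<Rightarrow> real" where
  "boundary_coord g z = side_coord (Arg2pi z * real (4 * g) / (2 * pi))"

lemma side_coord_int [simp]: "s \<in> \<int> \<Longrightarrow> side_coord s = - 1"
  by (simp add: side_coord_def)

lemma side_coord_add:
  assumes "0 < u" "u < 1"
  shows "side_coord (real m + u) = (if m mod 4 < 2 then real m + u else real m - 1 - u)"
proof -
  have fl: "\<lfloor>real m + u\<rfloor> = int m" using assms by linarith
  have "real m + u \<notin> \<int>"
  proof
    assume "real m + u \<in> \<int>"
    then obtain k where "real m + u = of_int k" by (rule Ints_cases)
    then have "int m < k" "k < int m + 1" using assms by linarith+
    then show False by simp
  qed
  moreover have "int m mod 4 < 2 \<longleftrightarrow> m mod 4 < 2" by presburger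
  ultimately show ?thesis using fl by (simp add: side_coord_def)
qed

lemma boundary_coord_polygon_boundary:
  assumes "0 < g" "0 \<le> s" "s \<le> real (4 * g)"
  shows "boundary_coord g (polygon_boundary g s) = side_coord s"
proof (cases "s = real (4 * g)")
  case True
  then have "polygon_boundary g s = 1" using assms(1) by (simp add: polygon_boundary_def)
  then show ?thesis using True Arg2pi_of_real[of 1] by (simp add: boundary_coord_def)
next
  case False
  have "Arg2pi (polygon_boundary g s) = 2 * pi * s / real (4 * g)"
  proof (rule Arg2pi_unique[of 1])
    show "2 * pi * s / real (4 * g) < 2 * pi"
      using assms False by (simp add: field_simps)
  qed (use assms in \<open>auto simp: polygon_boundary_def cis_conv_exp\<close>)
  then show ?thesis using assms(1) by (simp add: boundary_coord_def)
qed

lemma boundary_coord_side_pairing: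
  assumes "side_pairing g x y"
  shows "boundary_coord g x = boundary_coord g y"
  using assms
proof cases
  case (side_a j t)
  have g: "0 < g" "real (4 * j) + 4 \<le> real (4 * g)" using side_a(3) by linarith+
  have "side_coord (real (4 * j) + t) = side_coord (real (4 * j) + 3 - t)"
  proof (cases "t = 0 \<or> t = 1")
    case False
    have "4 * j mod 4 < 2" "\<not> (4 * j + 2) mod 4 < 2" by presburger+
    then have "side_coord (real (4 * j) + t) = real (4 * j) + t"
      "side_coord (real (4 * j + 2) + (1 - t)) = real (4 * j + 2) - 1 - (1 - t)"
      using False side_a by (intro trans[OF side_coord_add if_P] trans[OF side_coord_add if_not_P]; simp)+
    then show ?thesis by (simp add: algebra_simps)
  qed auto
  then show ?thesis using side_a g by (simp add: boundary_coord_polygon_boundary)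
next
  case (side_b j t)
  have g: "0 < g" "real (4 * j) + 4 \<le> real (4 * g)" using side_b(3) by linarith+
  have "side_coord (real (4 * j) + 1 + t) = side_coord (real (4 * j) + 4 - t)"
  proof (cases "t = 0 \<or> t = 1")
    case False
    have "(4 * j + 1) mod 4 < 2" "\<not> (4 * j + 3) mod 4 < 2" by presburger+
    then have "side_coord (real (4 * j + 1) + t) = real (4 * j + 1) + t"
      "side_coord (real (4 * j + 3) + (1 - t)) = real (4 * j + 3) - 1 - (1 - t)"
      using False side_b by (intro trans[OF side_coord_add if_P] trans[OF side_coord_add if_not_P]; simp)+
    then show ?thesis by (simp add: algebra_simps)
  qed auto
  then show ?thesis using side_b g by (simp add: boundary_coord_polygon_boundary)
qed

lemma boundary_coord_equivclp:
  "equivclp (side_pairing g) x y \<Longrightarrow> boundary_coord g x = boundary_coord g y"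
  by (induction rule: equivclp_induct) (auto dest: boundary_coord_side_pairing)

lemma equivclp_side_pairing_interior:
  assumes "equivclp (side_pairing g) x y" "norm x < 1"
  shows "x = y"
proof -
  have "y = x \<or> norm x = 1"
    using assms(1) by (induction rule: equivclp_induct) (auto dest: side_pairing_norm)
  then show ?thesis using assms(2) by auto
qed

text \<open>The map \<open>collapse g\<close> contracts a neighbourhood of each integer in \<open>[0, 4 * g]\<close> to that integer.\<close>

definition collapse :: "nat \<Rightarrow> real \<Rightarrow> real" where
  "collapse g s = (\<Sum>m<4 * g. max 0 (min 1 (2 * (s - real m) - 1 / 2)))"

lemma continuous_on_collapse [continuous_intros]:
  "continuous_on A h \<Longrightarrow> continuous_on A (\<lambda>x. collapse g (h x))"
  unfolding collapse_def by (intro continuous_intros)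

lemma collapse_eq:
  assumes "m < 4 * g" "real m \<le> s" "s \<le> real m + 1"
  shows "collapse g s = real m + max 0 (min 1 (2 * (s - real m) - 1 / 2))"
proof -
  let ?a = "\<lambda>i. max 0 (min 1 (2 * (s - real i) - 1 / 2))"
  have "(\<Sum>i<4 * g. ?a i) = (\<Sum>i<Suc m. ?a i) + (\<Sum>i=Suc m..<4 * g. ?a i)"
    using sum.atLeastLessThan_concat[of 0 "Suc m" "4 * g" ?a] assms(1) by (simp add: atLeast0LessThan)
  also have "(\<Sum>i=Suc m..<4 * g. ?a i) = 0" using assms by (intro sum.neutral) auto
  also have "(\<Sum>i<m. ?a i) = (\<Sum>i<m. 1)" using assms by (intro sum.cong) auto
  then have "(\<Sum>i<Suc m. ?a i) = real m + ?a m" by simp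
  finally show ?thesis by (simp add: collapse_def)
qed

lemma unit_interval_decomp:
  assumes "0 < n" "0 \<le> s" "s \<le> real n"
  obtains m where "m < n" "real m \<le> s" "s \<le> real m + 1"
proof (cases "s = real n")
  case True
  then show thesis using assms(1) by (intro that[of "n - 1"]) (auto simp: of_nat_diff)
next
  case False
  then show thesis using assms by (intro that[of "nat \<lfloor>s\<rfloor>"]) linarith+
qed

lemma collapse_near_int:
  assumes g: "0 < g" and s: "0 \<le> s" "s \<le> real (4 * g)" and N: "N \<in> \<int>" "\<bar>s - N\<bar> < 1 / 4"
  shows "collapse g s \<in> real ` {..4 * g}"
proof -
  obtain m where m: "m < 4 * g" "real m \<le> s" "s \<le> real m + 1"
    using unit_interval_decomp[of "4 * g" s] g s by auto
  obtain k where k: "N = of_int k" using N(1) by (auto elim: Ints_cases)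
  have "k = int m \<or> k = int m + 1" using m N(2) k by linarith
  then have "collapse g s = real m \<or> collapse g s = real (Suc m)"
    using collapse_eq[OF m] m N(2) k by (auto simp: max_def min_def)
  moreover have "m \<in> {..4 * g}" "Suc m \<in> {..4 * g}" using m(1) by auto
  ultimately show ?thesis by blast
qed

lemma collapse_int:
  assumes g: "0 < g" and s: "0 \<le> s" "s \<le> real (4 * g)" "s \<in> \<int>"
  shows "collapse g s = s"
proof -
  obtain m where m: "m < 4 * g" "real m \<le> s" "s \<le> real m + 1"
    using unit_interval_decomp[of "4 * g" s] g s by auto
  obtain k where k: "s = of_int k" using s(3) by (auto elim: Ints_cases)
  have "k = int m \<or> k = int m + 1" using m k by linarith
  then show ?thesis using collapse_eq[OF m] k by auto
qed

locale polygon_surface =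
  fixes g :: nat and f :: "complex \<Rightarrow> 's::real_normed_vector" and S :: "'s set"
  assumes g_pos: "0 < g"
    and f_cont: "continuous_on (cball 0 1) f"
    and f_image: "f ` cball 0 1 = S"
    and f_eq: "\<And>x y. norm x \<le> 1 \<Longrightarrow> norm y \<le> 1 \<Longrightarrow> f x = f y \<longleftrightarrow> equivclp (side_pairing g) x y"
begin

abbreviation edges :: "real \<Rightarrow> 's" where
  "edges s \<equiv> f (polygon_boundary g s)"

text \<open>One parameter interval \<open>[4 * j, 4 * j + 2]\<close> for each handle suffices to run through all edges
  of the surface.\<close>

definition handles :: "real set" where
  "handles = (\<Union>j<g. {real (4 * j) .. real (4 * j) + 2})"

lemma handles_bounds:
  assumes "s \<in> handles"
  shows "0 \<le> s" "s \<le> real (4 * g)"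
  using assms by (auto simp: handles_def)

lemma compact_handles: "compact handles"
  unfolding handles_def by (intro compact_UN) auto

lemma continuous_on_edges: "continuous_on A edges"
  by (rule continuous_on_compose2[OF f_cont]) (auto intro!: continuous_intros)

lemma f_side_a:
  "j < g \<Longrightarrow> 0 \<le> t \<Longrightarrow> t \<le> 1 \<Longrightarrow> edges (real (4 * j) + t) = edges (real (4 * j) + 3 - t)"
  using side_pairing.side_a[of j g t] by (subst f_eq) auto

lemma f_side_b:
  "j < g \<Longrightarrow> 0 \<le> t \<Longrightarrow> t \<le> 1 \<Longrightarrow> edges (real (4 * j) + 1 + t) = edges (real (4 * j) + 4 - t)"
  using side_pairing.side_b[of j g t] by (subst f_eq) auto

lemma f_interior:
  assumes "norm x < 1" "norm y \<le> 1" "f x = f y"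
  shows "x = y"
  using assms f_eq[of x y] equivclp_side_pairing_interior by simp

lemma side_coord_handles:
  assumes "s \<in> handles" "s \<notin> \<int>"
  shows "side_coord s = s"
proof -
  obtain j where j: "real (4 * j) \<le> s" "s \<le> real (4 * j) + 2"
    using assms(1) by (auto simp: handles_def)
  have "s \<noteq> real (4 * j) + 2" using assms(2) by auto
  then have "4 * int j \<le> \<lfloor>s\<rfloor>" "\<lfloor>s\<rfloor> < 4 * int j + 2"
    using j by linarith+
  then have "\<lfloor>s\<rfloor> mod 4 < 2" by presburger
  then show ?thesis using assms(2) by (simp add: side_coord_def)
qed

lemma edges_inj:
  assumes "s \<in> handles" "s' \<in> handles" "edges s = edges s'" "s \<notin> \<int>"
  shows "s = s'"
proof -
  have "side_coord s = side_coord s'"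
    using assms(3) boundary_coord_equivclp[of g "polygon_boundary g s" "polygon_boundary g s'"]
      boundary_coord_polygon_boundary[OF g_pos handles_bounds] assms(1,2) by (simp add: f_eq)
  moreover have "s' \<notin> \<int>"
    using calculation side_coord_handles[OF assms(1,4)] handles_bounds(1)[OF assms(1)] by auto
  ultimately show ?thesis using side_coord_handles assms by simp
qed

lemma edges_handles: "edges ` handles = f ` sphere 0 1"
proof (intro equalityI subsetI)
  fix y assume "y \<in> f ` sphere 0 1"
  then obtain z where z: "norm z = 1" "y = f z" by auto
  obtain s where s: "0 \<le> s" "s < real (4 * g)" "polygon_boundary g s = z"
    using polygon_boundary_surj[OF g_pos z(1)] by blast
  define m where "m = nat \<lfloor>s\<rfloor>"
  define j where "j = m div 4"
  have m: "real m \<le> s" "s \<le> real m + 1" "m < 4 * g" using s by (auto simp: m_def) linarith+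
  have j: "j < g" using m(3) by (auto simp: j_def)
  have h: "real (4 * j) + t \<in> handles" if "0 \<le> t" "t \<le> 2" for t
    using that j by (auto simp: handles_def intro!: bexI[of _ j])
  consider "m = 4 * j \<or> m = 4 * j + 1" | "m = 4 * j + 2" | "m = 4 * j + 3" unfolding j_def by linarith
  then show "y \<in> edges ` handles"
  proof cases
    case 1
    then show ?thesis using h[of "s - real (4 * j)"] m s z by auto
  next
    case 2
    let ?t = "real (4 * j) + 3 - s"
    have "edges (real (4 * j) + ?t) = edges s" using 2 m f_side_a[OF j, of ?t] by simp
    then show ?thesis using h[of ?t] 2 m s z by (intro image_eqI[of _ _ "real (4 * j) + ?t"]) auto
  next
    case 3
    let ?t = "real (4 * j) + 4 - s"
    have "edges (real (4 * j) + 1 + ?t) = edges s" using 3 m f_side_b[OF j, of ?t] by simp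
    then show ?thesis using h[of "1 + ?t"] 3 m s z
      by (intro image_eqI[of _ _ "real (4 * j) + (1 + ?t)"]) (auto simp: algebra_simps)
  qed
qed auto

end

locale polygon_rep = groupoid_rep M S w + polygon_surface g f S
  for M (structure) and S :: "'s::real_normed_vector set" and w g f
begin

lemma w_disc_cong:
  assumes "path q" "path_image q \<subseteq> cball 0 1" "\<And>t. t \<in> {0..1} \<Longrightarrow> p t = f (q t)"
  shows "w p = w (f \<circ> q)"
proof (rule w_cong[symmetric])
  show "path (f \<circ> q)"
    using assms by (intro path_continuous_image continuous_on_subset[OF f_cont])
  show "path_image (f \<circ> q) \<subseteq> S"
    using assms f_image by (auto simp: path_image_compose)
qed (use assms in auto)

lemma boundary_path_in_subgroup:
  assumes H: "subgroup H M"
    and disc: "\<And>q. path q \<Longrightarrow> path_image q \<subseteq> cball 0 1 \<Longrightarrow> w (f \<circ> q) \<in> H"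
    and p: "path p" "path_image p \<subseteq> f ` sphere 0 1"
  shows "w p \<in> H"
proof -
  interpret H: subgroup H M by fact
  have YS: "f ` sphere 0 1 \<subseteq> S" using f_image by auto
  define k where "k = (\<lambda>(t, s). edges ((1 - t) * s + t * collapse g s))"
  have k: "continuous_on ({0..1} \<times> handles) k"
    unfolding k_def case_prod_unfold
    by (intro continuous_on_compose2[OF continuous_on_edges[of UNIV]] continuous_intros) auto
  have fib: "k (t, s) = k (t, s')" if "s \<in> handles" "s' \<in> handles" "edges s = edges s'" for t s s'
  proof (cases "s = s'")
    case False
    then have "s \<in> \<int>" "s' \<in> \<int>" using edges_inj that by metis+
    then have "collapse g s = s" "collapse g s' = s'"
      using handles_bounds that collapse_int[OF g_pos] by auto
    then show ?thesis using that(3) by (simp add: k_def algebra_simps)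
  qed simp
  obtain h where h: "continuous_on ({0..1} \<times> f ` sphere 0 1) h"
    and hk: "\<And>t s. t \<in> {0..1} \<Longrightarrow> s \<in> handles \<Longrightarrow> h (t, edges s) = k (t, s)"
    using compact_quotient_homotopy[OF compact_handles continuous_on_edges k fib]
    unfolding edges_handles by blast
  have h_image: "h ` ({0..1} \<times> f ` sphere 0 1) \<subseteq> S"
    using hk f_image unfolding edges_handles[symmetric] by (auto simp: k_def)
  have h0: "h (0, z) = z" if "z \<in> f ` sphere 0 1" for z
    using that hk[of 0] unfolding edges_handles[symmetric] by (auto simp: k_def)
  have trace: "w (\<lambda>t. h (t, z)) \<in> H" if z: "z \<in> f ` sphere 0 1" for z
  proof -
    obtain s where s: "s \<in> handles" "z = edges s" using z unfolding edges_handles[symmetric] by auto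
    let ?q = "\<lambda>t. polygon_boundary g ((1 - t) * s + t * collapse g s)"
    have q: "path ?q" "path_image ?q \<subseteq> cball 0 1"
      by (auto simp: path_def path_image_def intro!: continuous_intros)
    have "w (\<lambda>t. h (t, z)) = w (f \<circ> ?q)"
      using s hk by (intro w_disc_cong[OF q]) (simp add: k_def)
    then show ?thesis using disc[OF q] by simp
  qed
  have push: "w u \<in> H" if "path u" "path_image u \<subseteq> f ` sphere 0 1" "w (\<lambda>t. h (1, u t)) \<in> H" for u
    by (rule w_in_subgroup_homotopy[OF H h h_image _ _ that]) (fact h0 trace)+
  show ?thesis
  proof (rule w_in_subgroup_local[OF H])
    show "path_image p \<subseteq> S" using p(2) YS by auto
    fix x :: real assume x: "x \<in> {0..1}"
    have "p x \<in> edges ` handles" using p(2) x by (auto simp: path_image_def edges_handles)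
    then obtain s where s: "s \<in> handles" "p x = edges s" by auto
    let ?near = "\<lambda>a b d. 0 \<le> a \<and> a \<le> x \<and> x \<le> b \<and> b \<le> 1 \<and> b - a < d"
    have sub: "path (subpath a b p)" "path_image (subpath a b p) \<subseteq> f ` sphere 0 1"
      if "?near a b d" for a b d
      using that p path_image_subpath_subset[of a b p] by auto
    show "\<exists>d>0. \<forall>a b. ?near a b d \<longrightarrow> w (subpath a b p) \<in> H"
    proof (cases "s \<in> \<int>")
      case True
      define E where "E = handles \<inter> (\<Inter>N\<in>\<int>. {u. 1 / 4 \<le> \<bar>u - N\<bar>})"
      have "compact E" unfolding E_def
        by (intro compact_Int_closed compact_handles closed_INT ballI closed_Collect_le continuous_intros)
      then have "closed (edges ` E)"
        by (intro compact_imp_closed compact_continuous_image continuous_on_edges)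
      moreover have "p x \<notin> edges ` E"
      proof
        assume "p x \<in> edges ` E"
        then obtain u where u: "u \<in> E" "edges u = edges s" using s by auto
        then have "u \<notin> \<int>" by (auto simp: E_def)
        then have "u = s" using u s by (intro edges_inj) (auto simp: E_def)
        then show False using True \<open>u \<notin> \<int>\<close> by simp
      qed
      ultimately obtain d where d: "d > 0" 
        "\<And>a b. ?near a b d \<Longrightarrow> path_image (subpath a b p) \<inter> edges ` E = {}"
        using path_avoids_closed_locally[OF p(1) _ x] by metis
      have "w (subpath a b p) \<in> H" if ab: "?near a b d" for a b
      proof (rule push[OF sub[OF ab]])
        let ?r = "\<lambda>t. h (1, subpath a b p t)"
        have sp: "subpath a b p t \<in> f ` sphere 0 1" if "t \<in> {0..1}" for t
          using sub(2)[OF ab] that by (auto simp: path_image_def)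
        have "continuous_on {0..1} ?r"
          using sub(1)[OF ab] sp unfolding path_def
          by (intro continuous_on_compose2[OF h] continuous_intros) auto
        then have r: "path ?r" by (simp add: path_def)
        have "?r t \<in> edges ` real ` {..4 * g}" if t: "t \<in> {0..1}" for t
        proof -
          obtain u where u: "u \<in> handles" "subpath a b p t = edges u"
            using sp[OF t] unfolding edges_handles[symmetric] by auto
          moreover have "subpath a b p t \<in> path_image (subpath a b p)"
            using t by (simp add: path_image_def)
          ultimately have "u \<notin> E" using d(2)[OF ab] by (metis disjoint_iff imageI)
          then obtain N where "N \<in> \<int>" "\<bar>u - N\<bar> < 1 / 4" using u(1) by (auto simp: E_def)
          then have "collapse g u \<in> real ` {..4 * g}"
            using collapse_near_int[OF g_pos] handles_bounds u by blast
          then show ?thesis using u hk by (auto simp: k_def)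
        qed
        then have r_image: "path_image ?r \<subseteq> edges ` real ` {..4 * g}" by (auto simp: path_image_def)
        then have "finite (path_image ?r)" by (rule finite_subset) auto
        then obtain c where c: "path_image ?r = {c}"
          using connected_path_image[OF r] path_image_nonempty[of ?r] connected_finite_iff_sing by metis
        have cS: "c \<in> S" using c r_image f_image by auto
        have "w ?r = w (linepath c c)"
          using c r cS by (intro w_cong) (auto simp: path_image_def linepath_def)
        then show "w ?r \<in> H" using w_linepath_same[OF cS] by simp
      qed
      then show ?thesis using d(1) by blast
    next
      case False
      obtain j where j: "j < g" "real (4 * j) \<le> s" "s \<le> real (4 * j) + 2"
        using s(1) by (auto simp: handles_def)
      have frac: "0 < frac s" "frac s < 1" using False by (auto simp: frac_gt_0_iff frac_lt_1)
      obtain e where e: "0 < e" "e < frac s" "e < 1 - frac s"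
        using frac field_lbound_gt_zero[of "frac s" "1 - frac s"] by (metis diff_gt_0_iff_gt)
      define T where "T = {s - e..s + e}"
      have fl: "real (4 * j) \<le> of_int \<lfloor>s\<rfloor>" "of_int \<lfloor>s\<rfloor> + 1 \<le> real (4 * j) + 2"
      proof -
        have "s \<noteq> real (4 * j) + 2" using False by auto
        then have "4 * int j \<le> \<lfloor>s\<rfloor>" "\<lfloor>s\<rfloor> < 4 * int j + 2"
          using j by linarith+
        then show "real (4 * j) \<le> of_int \<lfloor>s\<rfloor>" "of_int \<lfloor>s\<rfloor> + 1 \<le> real (4 * j) + 2" by linarith+
      qed
      have T_handles: "T \<subseteq> handles"
        using e fl j(1) by (auto simp: T_def handles_def frac_def intro!: bexI[of _ j])
      have T_int: "u \<notin> \<int>" if "u \<in> T" for u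
      proof
        assume "u \<in> \<int>"
        then obtain n where "u = of_int n" by (rule Ints_cases)
        moreover have "of_int \<lfloor>s\<rfloor> < u" "u < of_int \<lfloor>s\<rfloor> + 1" using that e by (auto simp: T_def frac_def)
        ultimately have "\<lfloor>s\<rfloor> < n" "n < \<lfloor>s\<rfloor> + 1" by linarith+
        then show False by simp
      qed
      have inj: "inj_on edges T"
        using edges_inj T_handles T_int by (intro inj_onI) blast
      define E where "E = handles - {s - e<..<s + e}"
      have "compact E" unfolding E_def by (intro compact_diff compact_handles) auto
      then have "closed (edges ` E)"
        by (intro compact_imp_closed compact_continuous_image continuous_on_edges)
      moreover have "p x \<notin> edges ` E"
      proof
        assume "p x \<in> edges ` E"
        then obtain u where u: "u \<in> E" "edges s = edges u" using s by auto
        then have "s = u" using s False by (intro edges_inj) (auto simp: E_def)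
        then show False using u(1) e(1) by (simp add: E_def)
      qed
      ultimately obtain d where d: "d > 0" 
        "\<And>a b. ?near a b d \<Longrightarrow> path_image (subpath a b p) \<inter> edges ` E = {}"
        using path_avoids_closed_locally[OF p(1) _ x] by metis
      have "w (subpath a b p) \<in> H" if ab: "?near a b d" for a b
      proof -
        have "path_image (subpath a b p) \<subseteq> edges ` handles - edges ` E"
          using sub(2)[OF ab] d(2)[OF ab] by (auto simp: edges_handles)
        also have "\<dots> \<subseteq> edges ` T" by (auto simp: E_def T_def)
        finally have sub_T: "path_image (subpath a b p) \<subseteq> edges ` T" .
        have "compact T" by (simp add: T_def)
        then obtain q where q: "path q" "path_image q \<subseteq> T" "\<And>t. t \<in> {0..1} \<Longrightarrow> edges (q t) = subpath a b p t"
          using path_lift_injective[OF _ continuous_on_edges inj sub(1)[OF ab] sub_T] by metis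
        let ?q = "\<lambda>t. polygon_boundary g (q t)"
        have q': "path ?q" "path_image ?q \<subseteq> cball 0 1"
          using q(1) by (auto simp: path_def path_image_def intro!: continuous_intros)
        have "w (subpath a b p) = w (f \<circ> ?q)"
          using q(3) by (intro w_disc_cong[OF q']) simp
        then show ?thesis using disc[OF q'] by simp
      qed
      then show ?thesis using d(1) by blast
    qed
  qed (use p in auto)
qed

lemma path_in_subgroup:
  assumes H: "subgroup H M"
    and disc: "\<And>q. path q \<Longrightarrow> path_image q \<subseteq> cball 0 1 \<Longrightarrow> w (f \<circ> q) \<in> H"
    and p: "path p" "path_image p \<subseteq> S"
  shows "w p \<in> H"
proof -
  interpret H: subgroup H M by fact
  define r where "r t y = y / of_real (max (norm y) (1 - t / 2))" for t :: real and y :: complex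
  define k where "k = (\<lambda>(t, y). f (r t y))"
  have r_norm: "norm (r t y) \<le> 1" if "t \<in> {0..1}" for t y
    using that by (auto simp: r_def norm_divide divide_simps)
  have r_cont: "continuous_on ({0..1} \<times> cball 0 1) (\<lambda>x. r (fst x) (snd x))"
    unfolding r_def by (intro continuous_intros) (auto simp: max_def)
  have k: "continuous_on ({0..1} \<times> cball 0 1) k"
    unfolding k_def case_prod_unfold
    using r_norm by (intro continuous_on_compose2[OF f_cont r_cont]) auto
  have r_sphere: "r t y = y" if "norm y = 1" "t \<in> {0..1}" for t y
  proof -
    have "max 1 (1 - t / 2) = 1" using that(2) by auto
    then show ?thesis using that(1) by (simp add: r_def)
  qed
  have fib: "k (t, y) = k (t, y')"
    if "t \<in> {0..1}" "y \<in> cball 0 1" "y' \<in> cball 0 1" "f y = f y'" for t y y'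
  proof (cases "y = y'")
    case False
    then have "norm y = 1" "norm y' = 1"
      using f_interior[of y y'] f_interior[of y' y] that by force+
    then show ?thesis using that r_sphere by (simp add: k_def)
  qed simp
  obtain h where h: "continuous_on ({0..1} \<times> S) h"
    and hk: "\<And>t y. t \<in> {0..1} \<Longrightarrow> y \<in> cball 0 1 \<Longrightarrow> h (t, f y) = k (t, y)"
    using compact_quotient_homotopy[OF compact_cball f_cont k fib] unfolding f_image by blast
  have h_image: "h ` ({0..1} \<times> S) \<subseteq> S"
    using hk r_norm unfolding f_image[symmetric] by (force simp: k_def)
  have h0: "h (0, z) = z" if "z \<in> S" for z
    using that hk[of 0] unfolding f_image[symmetric] by (auto simp: k_def r_def max_def)
  have trace: "w (\<lambda>t. h (t, z)) \<in> H" if z: "z \<in> S" for z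
  proof -
    obtain y where y: "y \<in> cball 0 1" "z = f y" using z unfolding f_image[symmetric] by auto
    have "continuous_on {0..1} (\<lambda>t. r t y)"
      unfolding r_def by (intro continuous_intros) (auto simp: max_def)
    then have q: "path (\<lambda>t. r t y)" "path_image (\<lambda>t. r t y) \<subseteq> cball 0 1"
      using r_norm by (auto simp: path_def path_image_def)
    have "w (\<lambda>t. h (t, z)) = w (f \<circ> (\<lambda>t. r t y))"
      using y hk by (intro w_disc_cong[OF q]) (simp add: k_def)
    then show ?thesis using disc[OF q] by simp
  qed
  have push: "w u \<in> H" if "path u" "path_image u \<subseteq> S" "w (\<lambda>t. h (1, u t)) \<in> H" for u
    by (rule w_in_subgroup_homotopy[OF H h h_image _ _ that]) (fact h0 trace)+
  show ?thesis
  proof (rule w_in_subgroup_local[OF H p])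
    fix x :: real assume x: "x \<in> {0..1}"
    have "p x \<in> f ` cball 0 1" using p(2) x by (auto simp: path_image_def f_image)
    then obtain y where y: "norm y \<le> 1" "p x = f y" by auto
    let ?near = "\<lambda>a b d. 0 \<le> a \<and> a \<le> x \<and> x \<le> b \<and> b \<le> 1 \<and> b - a < d"
    have sub: "path (subpath a b p)" "path_image (subpath a b p) \<subseteq> S"
      if "?near a b d" for a b d
      using that p path_image_subpath_subset[of a b p] by auto
    have closed_image: "closed (f ` E)" if "compact E" "E \<subseteq> cball 0 1" for E
      using that by (intro compact_imp_closed compact_continuous_image continuous_on_subset[OF f_cont])
    show "\<exists>d>0. \<forall>a b. ?near a b d \<longrightarrow> w (subpath a b p) \<in> H"
    proof (cases "norm y < 1")
      case True
      define e where "e = (1 + norm y) / 2"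
      have e: "norm y < e" "e < 1" using True by (auto simp: e_def)
      define E where "E = cball (0::complex) 1 - ball 0 e"
      have "closed (f ` E)" unfolding E_def by (intro closed_image compact_diff) auto
      moreover have "p x \<notin> f ` E"
      proof
        assume "p x \<in> f ` E"
        then obtain u where u: "u \<in> E" "f y = f u" using y by auto
        then have "y = u" using True by (intro f_interior) (auto simp: E_def)
        then show False using u(1) e(1) by (simp add: E_def)
      qed
      ultimately obtain d where d: "d > 0" 
        "\<And>a b. ?near a b d \<Longrightarrow> path_image (subpath a b p) \<inter> f ` E = {}"
        using path_avoids_closed_locally[OF p(1) _ x] by metis
      have inj: "inj_on f (cball 0 e)" using e f_interior by (intro inj_onI) auto
      have fT: "continuous_on (cball 0 e) f" using e by (intro continuous_on_subset[OF f_cont]) auto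
      have "w (subpath a b p) \<in> H" if ab: "?near a b d" for a b
      proof -
        have "path_image (subpath a b p) \<subseteq> f ` cball 0 1 - f ` E"
          using sub(2)[OF ab] d(2)[OF ab] by (auto simp: f_image)
        also have "\<dots> \<subseteq> f ` cball 0 e" by (auto simp: E_def)
        finally obtain q where q: "path q" "path_image q \<subseteq> cball 0 e" 
          "\<And>t. t \<in> {0..1} \<Longrightarrow> f (q t) = subpath a b p t"
          using path_lift_injective[OF compact_cball fT inj sub(1)[OF ab]] by metis
        have q': "path_image q \<subseteq> cball 0 1" using q(2) e by force
        have "w (subpath a b p) = w (f \<circ> q)"
          using q by (intro w_disc_cong[OF q(1) q']) simp
        then show ?thesis using disc[OF q(1) q'] by simp
      qed
      then show ?thesis using d(1) by blast
    next
      case False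
      have "closed (f ` cball 0 (1 / 2))" by (intro closed_image) auto
      moreover have "p x \<notin> f ` cball 0 (1 / 2)"
      proof
        assume "p x \<in> f ` cball 0 (1 / 2)"
        then obtain u where u: "norm u \<le> 1 / 2" "f u = f y" using y by auto
        then have "u = y" using y by (intro f_interior) auto
        then show False using u False by simp
      qed
      ultimately obtain d where d: "d > 0" 
        "\<And>a b. ?near a b d \<Longrightarrow> path_image (subpath a b p) \<inter> f ` cball 0 (1 / 2) = {}"
        using path_avoids_closed_locally[OF p(1) _ x] by metis
      have "w (subpath a b p) \<in> H" if ab: "?near a b d" for a b
      proof (rule push[OF sub[OF ab]])
        let ?r = "\<lambda>t. h (1, subpath a b p t)"
        have sp: "subpath a b p t \<in> S" if "t \<in> {0..1}" for t
          using sub(2)[OF ab] that by (auto simp: path_image_def)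
        have "continuous_on {0..1} ?r"
          using sub(1)[OF ab] sp unfolding path_def
          by (intro continuous_on_compose2[OF h] continuous_intros) auto
        then have r: "path ?r" by (simp add: path_def)
        have "?r t \<in> f ` sphere 0 1" if t: "t \<in> {0..1}" for t
        proof -
          obtain u where u: "norm u \<le> 1" "subpath a b p t = f u"
            using sp[OF t] unfolding f_image[symmetric] by auto
          moreover have "subpath a b p t \<in> path_image (subpath a b p)"
            using t by (simp add: path_image_def)
          ultimately have "u \<notin> cball 0 (1 / 2)" using d(2)[OF ab] by (metis disjoint_iff imageI)
          then have "norm (r 1 u) = 1" by (auto simp: r_def norm_divide)
          then show ?thesis using u hk[of 1 u] by (auto simp: k_def)
        qed
        then have r_image: "path_image ?r \<subseteq> f ` sphere 0 1" by (auto simp: path_image_def)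
        show "w ?r \<in> H" by (rule boundary_path_in_subgroup[OF H _ r r_image]) (rule disc)
      qed
      then show ?thesis using d(1) by blast
    qed
  qed
qed

end

section \<open>Generators of surface groups\<close>

context polygon_rep
begin

definition spoke :: "complex \<Rightarrow> 'a" where
  "spoke y = w (f \<circ> linepath 1 y)"

definition side_generators :: "'a set" where
  "side_generators =
     (\<lambda>j. spoke (polygon_boundary g (real (4 * j))) \<otimes>
           inv (spoke (polygon_boundary g (real (4 * j) + 3)))) ` {..<g} \<union>
     (\<lambda>j. spoke (polygon_boundary g (real (4 * j) + 1)) \<otimes>
           inv (spoke (polygon_boundary g (real (4 * j) + 4)))) ` {..<g}"

lemma disc_path:
  assumes "path q" "path_image q \<subseteq> cball 0 1"
  shows "path (f \<circ> q)" "path_image (f \<circ> q) \<subseteq> S"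
  using assms f_image
  by (auto simp: path_image_compose intro!: path_continuous_image continuous_on_subset[OF f_cont])

lemma path_image_spoke: "norm y \<le> 1 \<Longrightarrow> path_image (linepath 1 y) \<subseteq> cball (0::complex) 1"
  by (simp add: closed_segment_subset)

lemma spoke_closed: "norm y \<le> 1 \<Longrightarrow> spoke y \<in> carrier M"
  unfolding spoke_def using path_image_spoke by (intro w_closed disc_path) auto

lemma spoke_path:
  assumes q: "path q" "path_image q \<subseteq> cball 0 1"
  shows "spoke (pathstart q) \<otimes> w (f \<circ> q) = spoke (pathfinish q)"
proof -
  have n: "norm (pathstart q) \<le> 1" "norm (pathfinish q) \<le> 1"
    using q(2) pathstart_in_path_image[of q] pathfinish_in_path_image[of q] by auto
  have "spoke (pathstart q) \<otimes> w (f \<circ> q) = w ((f \<circ> linepath 1 (pathstart q)) +++ (f \<circ> q))"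
    unfolding spoke_def using path_image_spoke[OF n(1)] q disc_path
    by (intro w_join[symmetric]) (auto simp: pathfinish_compose pathstart_compose simp del: path_image_linepath)
  also have "\<dots> = w (f \<circ> (linepath 1 (pathstart q) +++ q))" by (simp add: path_compose_join)
  also have "\<dots> = spoke (pathfinish q)"
    unfolding spoke_def using n q f_cont f_image
    by (intro w_convex[of "cball 0 1"] subset_path_image_join path_image_spoke) simp_all
  finally show ?thesis .
qed

lemma side_generators_carrier: "side_generators \<subseteq> carrier M"
  unfolding side_generators_def using spoke_closed by auto

lemma finite_side_generators: "finite side_generators"
  by (simp add: side_generators_def)

lemma card_side_generators: "card side_generators \<le> 2 * g"
proof -
  have "card side_generators \<le> g + g"
    unfolding side_generators_def
    by (rule order_trans[OF card_Un_le add_mono]) (rule order_trans[OF card_image_le]; simp)+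
  then show ?thesis by simp
qed

text \<open>Both sides of an identified pair have the same image in the surface, so the quotient of the
  spokes to two identified points is the same along the whole side.\<close>

lemma spoke_side_pairing:
  assumes "side_pairing g x y"
  shows "spoke x \<otimes> inv (spoke y) \<in> generate M side_generators"
proof -
  have along: "spoke (polygon_boundary g (u + t)) \<otimes> inv (spoke (polygon_boundary g (v - t)))
      = spoke (polygon_boundary g u) \<otimes> inv (spoke (polygon_boundary g v))"
    if t: "0 \<le> t" "t \<le> 1" and eq: "\<And>s. 0 \<le> s \<Longrightarrow> s \<le> 1 \<Longrightarrow> edges (u + s) = edges (v - s)"
    for u v t :: real
  proof -
    let ?q = "\<lambda>s. polygon_boundary g (u + s * t)" and ?q' = "\<lambda>s. polygon_boundary g (v - s * t)"
    have q: "path ?q" "path_image ?q \<subseteq> cball 0 1" "path ?q'" "path_image ?q' \<subseteq> cball 0 1"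
      by (auto simp: path_def path_image_def intro!: continuous_intros)
    have "w (f \<circ> ?q) = w (f \<circ> ?q')"
      using t eq q by (intro w_disc_cong) (auto simp: mult_le_one)
    then have "spoke (polygon_boundary g (u + t)) = spoke (polygon_boundary g u) \<otimes> w (f \<circ> ?q)"
      "spoke (polygon_boundary g (v - t)) = spoke (polygon_boundary g v) \<otimes> w (f \<circ> ?q)"
      using spoke_path[OF q(1,2)] spoke_path[OF q(3,4)] by (simp_all add: pathstart_def pathfinish_def)
    moreover have "w (f \<circ> ?q) \<in> carrier M" using q disc_path by (intro w_closed) auto
    moreover have "a \<otimes> c \<otimes> inv (b \<otimes> c) = a \<otimes> inv b"
      if "a \<in> carrier M" "b \<in> carrier M" "c \<in> carrier M" for a b c
    proof -
      have "c \<otimes> (inv c \<otimes> inv b) = inv b" using that by (simp add: m_assoc[symmetric])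
      then show ?thesis using that by (simp add: inv_mult_group m_assoc)
    qed
    ultimately show ?thesis using spoke_closed by simp
  qed
  from assms show ?thesis
  proof cases
    case (side_a j t)
    have "spoke x \<otimes> inv (spoke y) \<in> side_generators"
      using along[of t "real (4 * j)" "real (4 * j) + 3"] f_side_a side_a
      unfolding side_generators_def by simp
    then show ?thesis by (rule generate.incl)
  next
    case (side_b j t)
    have "spoke x \<otimes> inv (spoke y) \<in> side_generators"
      using along[of t "real (4 * j) + 1" "real (4 * j) + 4"] f_side_b side_b
      unfolding side_generators_def by simp
    then show ?thesis by (rule generate.incl)
  qed
qed

lemma spoke_equivclp:
  assumes "equivclp (side_pairing g) x y" "norm x \<le> 1"
  shows "norm y \<le> 1 \<and> spoke x \<otimes> inv (spoke y) \<in> generate M side_generators"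
  using assms(1)
proof (induction rule: equivclp_induct)
  case base
  then show ?case using assms(2) spoke_closed generate.one by simp
next
  case (step y z)
  interpret H: subgroup "generate M side_generators" M
    using generate_is_subgroup[OF side_generators_carrier] .
  have n: "norm y = 1" "norm z = 1" using step(2) side_pairing_norm by auto
  have c: "spoke x \<in> carrier M" "spoke y \<in> carrier M" "spoke z \<in> carrier M"
    using assms(2) n spoke_closed by auto
  have "spoke y \<otimes> inv (spoke z) \<in> generate M side_generators"
    using step(2)
  proof
    assume "side_pairing g z y"
    then have "inv (spoke z \<otimes> inv (spoke y)) \<in> generate M side_generators"
      using spoke_side_pairing by simp
    then show ?thesis using c by (simp add: inv_mult_group)
  qed (rule spoke_side_pairing)
  then have "spoke x \<otimes> inv (spoke y) \<otimes> (spoke y \<otimes> inv (spoke z)) \<in> generate M side_generators"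
    using step by simp
  moreover have "spoke x \<otimes> inv (spoke y) \<otimes> (spoke y \<otimes> inv (spoke z)) = spoke x \<otimes> inv (spoke z)"
  proof -
    have "inv (spoke y) \<otimes> (spoke y \<otimes> inv (spoke z)) = inv (spoke z)"
      using c by (simp add: m_assoc[symmetric])
    then show ?thesis using c by (simp add: m_assoc)
  qed
  ultimately show ?case using n by simp
qed

lemma w_in_generate_side_generators:
  assumes \<sigma>: "\<And>z. z \<in> S \<Longrightarrow> norm (\<sigma> z) \<le> 1 \<and> f (\<sigma> z) = z \<and> spoke (\<sigma> z) = \<one>"
    and p: "path p" "path_image p \<subseteq> S"
  shows "w p \<in> generate M side_generators"
proof (rule path_in_subgroup[OF _ _ p])
  show H: "subgroup (generate M side_generators) M"
    using generate_is_subgroup[OF side_generators_carrier] .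
  interpret H: subgroup "generate M side_generators" M by (rule H)
  have spoke_in: "spoke y \<in> generate M side_generators" if "norm y \<le> 1" for y
  proof -
    have fy: "f y \<in> S" using that f_image by auto
    then have "equivclp (side_pairing g) y (\<sigma> (f y))" using \<sigma> that f_eq by metis
    then have "spoke y \<otimes> inv (spoke (\<sigma> (f y))) \<in> generate M side_generators"
      using spoke_equivclp that by blast
    then show ?thesis using \<sigma>[OF fy] spoke_closed[OF that] by simp
  qed
  fix q :: "real \<Rightarrow> complex" assume q: "path q" "path_image q \<subseteq> cball 0 1"
  have n: "norm (pathstart q) \<le> 1" "norm (pathfinish q) \<le> 1"
    using q(2) pathstart_in_path_image[of q] pathfinish_in_path_image[of q] by auto
  have "w (f \<circ> q) = inv (spoke (pathstart q)) \<otimes> spoke (pathfinish q)"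
    using spoke_path[OF q] w_closed[OF disc_path[OF q]] spoke_closed[OF n(1)]
    by (metis inv_solve_left m_closed)
  then show "w (f \<circ> q) \<in> generate M side_generators" using spoke_in n by simp
qed

end

lemma (in groupoid_rep) groupoid_rep_twist:
  assumes u: "\<And>z. z \<in> S \<Longrightarrow> u z \<in> carrier M"
  shows "groupoid_rep M S (\<lambda>p. u (pathstart p) \<otimes> w p \<otimes> inv (u (pathfinish p)))"
proof unfold_locales
  have ends: "u (pathstart p) \<in> carrier M" "u (pathfinish p) \<in> carrier M" if "path_image p \<subseteq> S" for p
    using that u pathstart_in_path_image[of p] pathfinish_in_path_image[of p] by auto
  fix p q
  show "u (pathstart p) \<otimes> w p \<otimes> inv (u (pathfinish p)) \<in> carrier M" if "path p" "path_image p \<subseteq> S"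
    using ends that w_closed by simp
  show "u (pathstart p) \<otimes> w p \<otimes> inv (u (pathfinish p)) = u (pathstart q) \<otimes> w q \<otimes> inv (u (pathfinish q))"
    if "homotopic_paths S p q"
    using that w_homotopic homotopic_paths_imp_pathstart homotopic_paths_imp_pathfinish by metis
  show "u (pathstart (p +++ q)) \<otimes> w (p +++ q) \<otimes> inv (u (pathfinish (p +++ q)))
      = u (pathstart p) \<otimes> w p \<otimes> inv (u (pathfinish p)) \<otimes> (u (pathstart q) \<otimes> w q \<otimes> inv (u (pathfinish q)))"
    if pq: "path p" "path_image p \<subseteq> S" "path q" "path_image q \<subseteq> S" "pathfinish p = pathstart q"
  proof -
    note c = ends[OF pq(2)] ends[OF pq(4)] w_closed[OF pq(1,2)] w_closed[OF pq(3,4)]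
    have "inv (u (pathstart q)) \<otimes> (u (pathstart q) \<otimes> a) = a" if "a \<in> carrier M" for a
      using c that by (simp add: m_assoc[symmetric])
    then show ?thesis using c pq w_join by (simp add: m_assoc)
  qed
qed

lemma homotopic_paths_cancel_middle:
  fixes S :: "'s::real_normed_vector set"
  assumes "path a" "path_image a \<subseteq> S" "path p" "path_image p \<subseteq> S"
    "path b" "path_image b \<subseteq> S" "path r" "path_image r \<subseteq> S"
    "pathfinish a = pathstart p" "pathfinish p = pathfinish b" "pathfinish b = pathstart r"
    "pathstart b = pathstart a"
  shows "homotopic_paths S ((a +++ (p +++ reversepath b)) +++ (b +++ r)) (a +++ (p +++ r))"
proof -
  have refl: "homotopic_paths S a a" "homotopic_paths S p p" "homotopic_paths S r r" using assms by auto
  have img: "path_image (b +++ r) \<subseteq> S" "path_image (p +++ reversepath b) \<subseteq> S"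
    using assms by (simp_all add: path_image_join)
  have "homotopic_paths S (reversepath b +++ (b +++ r)) ((reversepath b +++ b) +++ r)"
    using assms by (intro homotopic_paths_assoc) simp_all
  also have "homotopic_paths S \<dots> (linepath (pathfinish b) (pathfinish b) +++ r)"
    using assms refl by (intro homotopic_paths_join homotopic_paths_linv) simp_all
  also have "homotopic_paths S \<dots> r"
    using assms by (intro homotopic_paths_lid') simp_all
  finally have *: "homotopic_paths S (reversepath b +++ (b +++ r)) r" .
  have "homotopic_paths S ((p +++ reversepath b) +++ (b +++ r)) (p +++ (reversepath b +++ (b +++ r)))"
    using assms img by (intro homotopic_paths_sym[OF homotopic_paths_assoc]) simp_all
  also have "homotopic_paths S \<dots> (p +++ r)"
    by (rule homotopic_paths_join[OF refl(2) *]) (use assms in simp)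
  finally have **: "homotopic_paths S ((p +++ reversepath b) +++ (b +++ r)) (p +++ r)" .
  have "homotopic_paths S ((a +++ (p +++ reversepath b)) +++ (b +++ r))
      (a +++ ((p +++ reversepath b) +++ (b +++ r)))"
    using assms img by (intro homotopic_paths_sym[OF homotopic_paths_assoc]) simp_all
  also have "homotopic_paths S \<dots> (a +++ (p +++ r))"
    by (rule homotopic_paths_join[OF refl(1) **]) (use assms in simp)
  finally show ?thesis .
qed

lemma groupoid_rep_fundamental_group:
  fixes S :: "'s::real_normed_vector set"
  assumes S: "path_connected S" "x \<in> S"
  obtains w where "groupoid_rep (fundamental_group S x) S w"
    and "\<And>m. m \<in> carrier (fundamental_group S x) \<Longrightarrow>
      \<exists>l. path l \<and> path_image l \<subseteq> S \<and> pathstart l = x \<and> pathfinish l = x \<and> w l = m"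
proof -
  let ?M = "fundamental_group S x"
  define c where "c z = (if z = x then linepath x x else
    SOME p. path p \<and> path_image p \<subseteq> S \<and> pathstart p = x \<and> pathfinish p = z)" for z
  have c: "path (c z)" "path_image (c z) \<subseteq> S" "pathstart (c z) = x" "pathfinish (c z) = z" if "z \<in> S" for z
  proof -
    have "\<exists>p. path p \<and> path_image p \<subseteq> S \<and> pathstart p = x \<and> pathfinish p = z"
      using S that unfolding path_connected_def by blast
    from someI_ex[OF this] have "path (c z) \<and> path_image (c z) \<subseteq> S \<and> pathstart (c z) = x \<and> pathfinish (c z) = z"
      using S(2) by (cases "z = x") (simp_all add: c_def)
    then show "path (c z)" "path_image (c z) \<subseteq> S" "pathstart (c z) = x" "pathfinish (c z) = z" by auto
  qed
  define loop where "loop p = c (pathstart p) +++ (p +++ reversepath (c (pathfinish p)))" for p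
  define w where "w p = homotopy_class S (loop p)" for p
  have loop: "loop p \<in> loops_at S x" if p: "path p" "path_image p \<subseteq> S" for p
  proof -
    have "pathstart p \<in> S" "pathfinish p \<in> S"
      using p(2) pathstart_in_path_image[of p] pathfinish_in_path_image[of p] by auto
    then show ?thesis using c p by (simp add: loop_def loops_at_def path_image_join)
  qed
  have "groupoid_rep ?M S w"
  proof (intro groupoid_rep.intro groupoid_rep_axioms.intro)
    show "group ?M" using S(2) by (rule group_fundamental_group)
    fix p q :: "real \<Rightarrow> 's"
    show "w p \<in> carrier ?M" if "path p" "path_image p \<subseteq> S"
      using loop[OF that] by (simp add: w_def fundamental_group_def)
    show "w p = w q" if pq: "homotopic_paths S p q"
    proof -
      have p: "path p" "path_image p \<subseteq> S" "pathstart q = pathstart p" "pathfinish q = pathfinish p"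
        using pq homotopic_paths_imp_path homotopic_paths_imp_subset
          homotopic_paths_imp_pathstart homotopic_paths_imp_pathfinish by metis+
      have e: "pathstart p \<in> S" "pathfinish p \<in> S"
        using p(2) pathstart_in_path_image[of p] pathfinish_in_path_image[of p] by auto
      have "homotopic_paths S (loop p) (loop q)"
        unfolding loop_def p(3,4) using c e pq p by (intro homotopic_paths_join) auto
      then show ?thesis unfolding w_def by (rule homotopy_class_eqI)
    qed
    show "w (p +++ q) = w p \<otimes>\<^bsub>?M\<^esub> w q"
      if p: "path p" "path_image p \<subseteq> S" and q: "path q" "path_image q \<subseteq> S" and pq: "pathfinish p = pathstart q"
    proof -
      have e: "pathstart p \<in> S" "pathstart q \<in> S" "pathfinish q \<in> S"
        using p(2) q(2) pathstart_in_path_image[of p] pathstart_in_path_image[of q]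
          pathfinish_in_path_image[of q] by auto
      let ?a = "c (pathstart p)" and ?b = "c (pathstart q)" and ?c = "c (pathfinish q)"
      let ?r = "q +++ reversepath ?c"
      note simps = c[OF e(1)] c[OF e(2)] c[OF e(3)] p q pq
      have r: "path ?r" "path_image ?r \<subseteq> S" "pathstart ?r = pathstart q"
        using simps by (simp_all add: path_image_join)
      have "homotopic_paths S (loop p +++ loop q) (?a +++ (p +++ ?r))"
        unfolding loop_def pq using simps r by (intro homotopic_paths_cancel_middle) simp_all
      also have "homotopic_paths S \<dots> (?a +++ ((p +++ q) +++ reversepath ?c))"
        using simps r by (intro homotopic_paths_join homotopic_paths_assoc) simp_all
      finally have "homotopic_paths S (loop p +++ loop q) (loop (p +++ q))" by (simp add: loop_def)
      then show ?thesis
        unfolding w_def using loop p q by (simp add: fundamental_group_mult homotopy_class_eqI)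
    qed
  qed
  moreover have "\<exists>l. path l \<and> path_image l \<subseteq> S \<and> pathstart l = x \<and> pathfinish l = x \<and> w l = m"
    if m: "m \<in> carrier ?M" for m
  proof -
    obtain l where l: "l \<in> loops_at S x" "m = homotopy_class S l"
      using m by (auto simp: fundamental_group_def)
    then have l': "path l" "path_image l \<subseteq> S" "pathstart l = x" "pathfinish l = x"
      by (auto simp: loops_at_def)
    have "homotopic_paths S (linepath x x +++ (l +++ linepath x x)) (l +++ linepath x x)"
      using l' S(2) by (intro homotopic_paths_lid') (auto simp: path_image_join)
    also have "homotopic_paths S \<dots> l" using l' by (intro homotopic_paths_rid') auto
    finally have "w l = m" using l l' by (simp add: w_def loop_def c_def homotopy_class_eqI)
    then show ?thesis using l' by blast
  qed
  ultimately show thesis using that by blast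
qed

theorem closed_orientable_surface_generators:
  fixes S :: "'s::real_normed_vector set"
  assumes "closed_orientable_surface g S" and "x \<in> S" and g: "0 < g"
  shows "\<exists>B\<subseteq>carrier (fundamental_group S x). finite B \<and> card B \<le> 2 * g \<and>
    generate (fundamental_group S x) B = carrier (fundamental_group S x)"
proof -
  let ?M = "fundamental_group S x"
  obtain f where f: "quotient_map (top_of_set (cball (0::complex) 1)) (top_of_set S) f"
    "\<And>x y. x \<in> cball 0 1 \<Longrightarrow> y \<in> cball 0 1 \<Longrightarrow> f x = f y \<longleftrightarrow> equivclp (side_pairing g) x y"
    using assms(1) by (auto simp: closed_orientable_surface_def)
  interpret polygon_surface g f S
  proof
    show "continuous_on (cball 0 1) f"
      using quotient_imp_continuous_map[OF f(1)] by (simp add: continuous_map_in_subtopology)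
    show "f ` cball 0 1 = S" using quotient_imp_surjective_map[OF f(1)] by simp
  qed (use f(2) g in auto)
  have "path_connected S"
    using path_connected_continuous_image[OF f_cont convex_imp_path_connected[OF convex_cball]] f_image by simp
  then obtain w where w: "groupoid_rep ?M S w"
    and w_surj: "\<And>m. m \<in> carrier ?M \<Longrightarrow>
      \<exists>l. path l \<and> path_image l \<subseteq> S \<and> pathstart l = x \<and> pathfinish l = x \<and> w l = m"
    using groupoid_rep_fundamental_group[OF _ assms(2)] by metis
  interpret W: polygon_rep ?M S w g f
    using w polygon_surface_axioms by (simp add: polygon_rep_def)
  define \<sigma> where "\<sigma> z = (if z = f 1 then 1 else SOME y. norm y \<le> 1 \<and> f y = z)" for z
  have \<sigma>: "norm (\<sigma> z) \<le> 1 \<and> f (\<sigma> z) = z" if z: "z \<in> S" for z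
  proof -
    have "\<exists>y. norm y \<le> 1 \<and> f y = z" using z f_image by auto
    from someI_ex[OF this] show ?thesis by (simp add: \<sigma>_def)
  qed
  define u where "u z = W.spoke (\<sigma> z)" for z
  have uc: "u z \<in> carrier ?M" if "z \<in> S" for z
    using \<sigma>[OF that] W.spoke_closed by (simp add: u_def)
  have f1: "f 1 \<in> S" using f_image by auto
  have u1: "u (f 1) = \<one>\<^bsub>?M\<^esub>"
    using W.w_linepath_same[OF f1] by (simp add: u_def \<sigma>_def W.spoke_def comp_def linepath_refl)
  define v where "v p = u (pathstart p) \<otimes>\<^bsub>?M\<^esub> w p \<otimes>\<^bsub>?M\<^esub> inv\<^bsub>?M\<^esub> (u (pathfinish p))" for p
  interpret V: polygon_rep ?M S v g f
    using W.groupoid_rep_twist[OF uc] polygon_surface_axioms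
    by (simp add: polygon_rep_def v_def[abs_def])
  have "V.spoke (\<sigma> z) = \<one>\<^bsub>?M\<^esub>" if z: "z \<in> S" for z
    using \<sigma>[OF z] uc[OF z] u1
    by (simp add: V.spoke_def v_def pathstart_compose pathfinish_compose W.spoke_def[symmetric] u_def[symmetric])
  then have gen: "v p \<in> generate ?M V.side_generators" if "path p" "path_image p \<subseteq> S" for p
    using V.w_in_generate_side_generators[of \<sigma>] \<sigma> that by blast
  have "carrier ?M \<subseteq> generate ?M V.side_generators"
  proof
    fix m assume m: "m \<in> carrier ?M"
    then have "inv\<^bsub>?M\<^esub> (u x) \<otimes>\<^bsub>?M\<^esub> m \<otimes>\<^bsub>?M\<^esub> u x \<in> carrier ?M" using uc assms(2) by simp
    from w_surj[OF this] obtain l where l: "path l" "path_image l \<subseteq> S" "pathstart l = x" "pathfinish l = x"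
      "w l = inv\<^bsub>?M\<^esub> (u x) \<otimes>\<^bsub>?M\<^esub> m \<otimes>\<^bsub>?M\<^esub> u x" by blast
    have "v l = m"
      using l m uc[OF assms(2)] W.conjugation_is_surj by (simp add: v_def)
    then show "m \<in> generate ?M V.side_generators" using gen l by metis
  qed
  then have "generate ?M V.side_generators = carrier ?M"
    using W.generate_incl[OF V.side_generators_carrier] by blast
  then show ?thesis
    using V.side_generators_carrier V.finite_side_generators V.card_side_generators by blast
qed

section \<open>The index of the normalizer\<close>

lemma surface_group_generators:
  assumes "surface_group g K"
  shows "\<exists>B\<subseteq>carrier K. finite B \<and> card B \<le> 2 * g \<and> generate K B = carrier K"
proof -
  obtain S :: "(real ^ 3) set" and x where S: "closed_orientable_surface g S" "x \<in> S"
    and g: "2 \<le> g" and iso: "K \<cong> fundamental_group S x" and K: "group K"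
    using assms by (auto simp: surface_group_def)
  let ?M = "fundamental_group S x"
  obtain h where h: "h \<in> iso ?M K" using group.iso_sym[OF K iso] by (auto simp: is_iso_def)
  then interpret h: group_hom ?M K h
    using K group_fundamental_group[OF S(2)]
    by (simp add: group_hom_def group_hom_axioms_def iso_def)
  obtain B where B: "B \<subseteq> carrier ?M" "finite B" "card B \<le> 2 * g" "generate ?M B = carrier ?M"
    using closed_orientable_surface_generators[OF S] g by auto
  have "generate K (h ` B) = h ` carrier ?M" using h.generate_img[OF B(1)] B(4) by simp
  then have "generate K (h ` B) = carrier K" using h by (simp add: iso_def bij_betw_def)
  moreover have "card (h ` B) \<le> 2 * g" using B card_image_le order_trans by blast
  ultimately show ?thesis using B by (intro exI[of _ "h ` B"]) auto
qed

lemma central_extension_fiber: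
  assumes "central_extension A \<iota> E \<phi> Q" "finite (carrier A)"
  shows "finite {x \<in> carrier E. \<phi> x = y} \<and> card {x \<in> carrier E. \<phi> x = y} \<le> order A"
proof (cases "{x \<in> carrier E. \<phi> x = y} = {}")
  case False
  then obtain z where z: "z \<in> carrier E" "\<phi> z = y" by auto
  interpret group_hom E Q \<phi>
    using assms(1) by (simp add: central_extension_def group_extension_def group_hom_def group_hom_axioms_def)
  have ker: "kernel E Q \<phi> = \<iota> ` carrier A"
    using assms(1) by (simp add: central_extension_def group_extension_def)
  have "{x \<in> carrier E. \<phi> x = y} \<subseteq> (\<lambda>a. z \<otimes>\<^bsub>E\<^esub> \<iota> a) ` carrier A"
  proof
    fix x assume x: "x \<in> {x \<in> carrier E. \<phi> x = y}"
    then have "inv\<^bsub>E\<^esub> z \<otimes>\<^bsub>E\<^esub> x \<in> kernel E Q \<phi>"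
      using z hom_closed[OF z(1)] by (simp add: kernel_def)
    then obtain a where "a \<in> carrier A" "\<iota> a = inv\<^bsub>E\<^esub> z \<otimes>\<^bsub>E\<^esub> x" unfolding ker by auto
    moreover have "z \<otimes>\<^bsub>E\<^esub> (inv\<^bsub>E\<^esub> z \<otimes>\<^bsub>E\<^esub> x) = x" using x z by (simp add: G.m_assoc[symmetric])
    ultimately show "x \<in> (\<lambda>a. z \<otimes>\<^bsub>E\<^esub> \<iota> a) ` carrier A" by force
  qed
  then show ?thesis
    using assms(2) unfolding order_def by (meson card_image_le card_mono finite_imageI finite_subset order_trans)
next
  case True
  then show ?thesis by (simp only: finite.emptyI card.empty) simp
qed

lemma (in group) group_exponent_bounds:
  assumes fin: "finite (carrier G)"
  shows "1 \<le> group_exponent G" and "order G \<noteq> 1 \<Longrightarrow> 2 \<le> group_exponent G"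
proof -
  let ?P = "\<lambda>k. 0 < k \<and> (\<forall>x\<in>carrier G. x [^] k = \<one>)"
  have "?P (order G)" using fin order_gt_0_iff_finite pow_order_eq_1 by simp
  then have P: "?P (group_exponent G)" unfolding group_exponent_def by (rule LeastI)
  then show "1 \<le> group_exponent G" by simp
  show "2 \<le> group_exponent G" if "order G \<noteq> 1"
  proof (rule ccontr)
    assume "\<not> 2 \<le> group_exponent G"
    then have "group_exponent G = 1" using P by linarith
    then have "\<forall>x\<in>carrier G. x = \<one>" using P by simp
    then have "carrier G = {\<one>}" by auto
    then show False using that by (simp add: order_def)
  qed
qed

lemma power_le_mult_fact_power:
  assumes "1 \<le> (e::nat)"
  shows "e ^ m \<le> e * fact e ^ (m + r)" and "2 \<le> e \<Longrightarrow> e ^ m < e * fact e ^ (m + r)"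
proof -
  have "e ^ m \<le> fact e ^ m" by (intro power_mono fact_ge_self) simp
  also have "(fact e :: nat) ^ m \<le> fact e ^ (m + r)" by (intro power_increasing) (simp_all add: fact_ge_1)
  finally have le: "e ^ m \<le> fact e ^ (m + r)" .
  also have "\<dots> \<le> e * fact e ^ (m + r)" using assms by simp
  finally show "e ^ m \<le> e * fact e ^ (m + r)" .
  show "e ^ m < e * fact e ^ (m + r)" if "2 \<le> e"
  proof -
    have "fact e ^ (m + r) < e * fact e ^ (m + r)" using that by simp
    then show ?thesis using le by (rule le_less_trans[rotated])
  qed
qed

theorem lemma3p3:
  fixes A :: "('a, 'k) monoid_scheme"
    and G :: "('g, 'm) monoid_scheme"
    and \<Gamma> :: "('e, 'l) monoid_scheme"
    and F :: "nat \<Rightarrow> 'g set" and n g\<^sub>1 :: nat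
    and R :: "'a set"
    and \<iota> :: "'a \<Rightarrow> 'e" and \<phi> :: "'e \<Rightarrow> 'g"
    and G\<^sub>1' :: "'g set" and i :: "'g \<Rightarrow> 'e"
  assumes "comm_group A" and "finite (carrier A)"
    and "minimal_generating_set A R"
    and "1 \<le> n" and "polysurface_group G n F"
    and "surface_group g\<^sub>1 (G\<lparr>carrier := F 1\<rparr>)"
    and "central_extension A \<iota> \<Gamma> \<phi> G"
    and "G\<^sub>1' \<lhd> G\<lparr>carrier := F 1\<rparr>"
    and "finite (rcosets\<^bsub>G\<lparr>carrier := F 1\<rparr>\<^esub> G\<^sub>1')"
    and "card (rcosets\<^bsub>G\<lparr>carrier := F 1\<rparr>\<^esub> G\<^sub>1') \<le> group_exponent A"
    and "cyclic_group ((G\<lparr>carrier := F 1\<rparr>) Mod G\<^sub>1')"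
    and "trivial_extension A \<iota> (\<Gamma>\<lparr>carrier := {x \<in> carrier \<Gamma>. \<phi> x \<in> G\<^sub>1'}\<rparr>) \<phi> (G\<lparr>carrier := G\<^sub>1'\<rparr>)"
    and "i \<in> hom (G\<lparr>carrier := G\<^sub>1'\<rparr>) \<Gamma>" and "\<forall>x\<in>G\<^sub>1'. \<phi> (i x) = x"
  shows "let e = group_exponent A;
             B = order A ^ (2 * e * g\<^sub>1) * e * fact e ^ (2 * g\<^sub>1 + card R);
             cosets = rcosets\<^bsub>\<Gamma>\<^esub> (normalizer \<Gamma> (i ` G\<^sub>1'))
         in finite cosets \<and> card cosets \<le> B \<and> (order A \<noteq> 1 \<longrightarrow> card cosets < B)"
proof -
  interpret A: comm_group A by fact
  interpret \<phi>: group_hom \<Gamma> G \<phi>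
    using assms(7)
    by (simp add: central_extension_def group_extension_def group_hom_def group_hom_axioms_def)
  let ?K = "G\<lparr>carrier := F 1\<rparr>"
  define e where "e = group_exponent A"
  define k where "k = card (rcosets\<^bsub>?K\<^esub> G\<^sub>1')"
  have K: "F 1 \<lhd> G" using assms(4,5) by (simp add: polysurface_group_def)
  then interpret K: normal "F 1" G .
  have groupK: "group ?K" using K.subgroup_is_group \<phi>.H.is_group by blast
  obtain B where B: "B \<subseteq> F 1" "finite B" "card B \<le> 2 * g\<^sub>1" "generate ?K B = F 1"
    using surface_group_generators[OF assms(6)] by auto
  have gB: "generate G B = F 1"
    using \<phi>.H.generate_consistent[OF B(1) K.subgroup_axioms] B(4) by simp
  have a: "1 \<le> order A" using assms(2) A.order_gt_0_iff_finite by simp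
  have lift: "\<And>x. x \<in> G\<^sub>1' \<Longrightarrow> \<phi> (i x) = x" using assms(14) by simp
  let ?C = "(\<lambda>d. conjugate \<Gamma> d (i ` G\<^sub>1')) ` carrier \<Gamma>"
  have C: "finite ?C" "card ?C \<le> k ^ card B * order A ^ (k * card B)"
    using card_conjugates_of_lift[OF \<phi>.group_hom_axioms K B(1,2) gB assms(8,9,13) lift
        central_extension_fiber[OF assms(7,2)] a]
    by (simp_all add: k_def)
  have iN: "i ` G\<^sub>1' \<subseteq> carrier \<Gamma>" using assms(13) by (auto simp: hom_def)
  note index = \<phi>.G.card_rcosets_normalizer[OF iN C(1)]
  have k: "1 \<le> k" "k \<le> e"
    using finite_rcosets_pos[OF assms(9) groupK] assms(10) by (simp_all add: k_def e_def)
  have e: "1 \<le> e" "order A \<noteq> 1 \<Longrightarrow> 2 \<le> e"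
    using A.group_exponent_bounds[OF assms(2)] by (simp_all add: e_def)
  have "k ^ card B \<le> k ^ (2 * g\<^sub>1)" using k(1) B(3) by (rule power_increasing[rotated])
  also have "\<dots> \<le> e ^ (2 * g\<^sub>1)" using k(2) by (rule power_mono) simp
  finally have kB: "k ^ card B \<le> e ^ (2 * g\<^sub>1)" .
  have "k * card B \<le> e * (2 * g\<^sub>1)" using k(2) B(3) by (rule mult_le_mono)
  then have "order A ^ (k * card B) \<le> order A ^ (2 * e * g\<^sub>1)"
    using a by (intro power_increasing) (simp_all add: ac_simps)
  then have bound: "card ?C \<le> e ^ (2 * g\<^sub>1) * order A ^ (2 * e * g\<^sub>1)"
    using C(2) kB mult_le_mono order_trans by blast
  have pos: "0 < order A ^ (2 * e * g\<^sub>1)" using a by simp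
  have "card ?C \<le> order A ^ (2 * e * g\<^sub>1) * (e * fact e ^ (2 * g\<^sub>1 + card R))"
  proof (rule order_trans)
    show "card ?C \<le> order A ^ (2 * e * g\<^sub>1) * e ^ (2 * g\<^sub>1)" using bound by (simp only: mult.commute)
  qed (intro mult_le_mono2 power_le_mult_fact_power(1)[OF e(1)])
  moreover have "card ?C < order A ^ (2 * e * g\<^sub>1) * (e * fact e ^ (2 * g\<^sub>1 + card R))" if "order A \<noteq> 1"
  proof -
    have "e ^ (2 * g\<^sub>1) < e * fact e ^ (2 * g\<^sub>1 + card R)"
      using power_le_mult_fact_power(2)[OF e(1) e(2)[OF that]] .
    then have "order A ^ (2 * e * g\<^sub>1) * e ^ (2 * g\<^sub>1)
        < order A ^ (2 * e * g\<^sub>1) * (e * fact e ^ (2 * g\<^sub>1 + card R))"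
      using pos by (rule mult_strict_left_mono)
    then show ?thesis using bound by (simp only: mult.commute)
  qed
  ultimately show ?thesis
    using index by (simp add: Let_def e_def mult.assoc)
qed

end
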